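(* Let $P\subset\mathbb{H}^3$ be a convex ideal polyhedron with $\overline{E}$ edges and $\overline{V}$ (ideal) vertices which is a fundamental polyhedron for a Kleinian group $G$, such that no face pairing transformation is elliptic and, for every edge class, the sum of the interior dihedral angles of $P$ at the edges of the class equals $2\pi$. Then the number $E$ of edge classes of $P$ is $$E=\frac{\overline{E}-\overline{V}}{2}.$$
   Context: A Kleinian group is a discrete group of orientation-preserving isometries of $\mathbb{H}^3$. A fundamental polyhedron $P$ for $G$ is a convex polyhedron such that: its faces are arranged in pairs $(\sigma,\sigma')$ of distinct faces, each pair having a face pairing transformation $g\in G$ with $g(\sigma)=\sigma'$ and $g(P)\cap P=\sigma'$; the translates of $P$ under $G$ fill $\mathbb{H}^3$ without overlap of interiors; the face pairing transformations generate $G$. The edge classes are the equivalence classes of edges of $P$ under the identifications induced by the face pairing transformations. A convex ideal polyhedron is one all of whose vertices lie on the sphere at infinity; for such a polyhedron the exterior dihedral angles ($\pi$ minus the interior dihedral angles) at the edges incident to any given vertex sum to $2\pi$. *)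

theory Defs
  imports "HOL-Analysis.Analysis" "HOL-Algebra.Bij" "HOL-Algebra.Generated_Groups"
begin

text \<open>
  Hyperbolic 3-space in the projective (Klein) model: the open unit ball, with the unit sphere as
  the sphere at infinity. Geodesics are Euclidean segments, so hyperbolic convexity, half-spaces,
  faces and edges are the Euclidean ones and the library notions apply.
\<close>

definition hyp3 :: "(real ^ 3) set"
  where "hyp3 = ball 0 1"

text \<open>
  The embedding of the ball into the hyperboloid of Minkowski space that sends \<open>x\<close> to
  \<open>(x, 1) / sqrt (1 - x \<bullet> x)\<close> identifies the following with the metric \<open>arcosh (- \<langle>X, Y\<rangle>)\<close>
  of the hyperboloid model and with the Riemannian metric induced by the Minkowski form.
\<close>

definition hdist :: "real ^ 3 \<Rightarrow> real ^ 3 \<Rightarrow> real"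
  where "hdist x y = arcosh ((1 - x \<bullet> y) / (sqrt (1 - x \<bullet> x) * sqrt (1 - y \<bullet> y)))"

definition hinner :: "real ^ 3 \<Rightarrow> real ^ 3 \<Rightarrow> real ^ 3 \<Rightarrow> real"
  where "hinner x u v =
    (u \<bullet> v) / (1 - x \<bullet> x) + ((x \<bullet> u) * (x \<bullet> v)) / (1 - x \<bullet> x)\<^sup>2"

definition hangle :: "real ^ 3 \<Rightarrow> real ^ 3 \<Rightarrow> real ^ 3 \<Rightarrow> real"
  where "hangle x u v = arccos (hinner x u v / (sqrt (hinner x u u) * sqrt (hinner x v v)))"

text \<open>
  Isometries are represented as elements of \<open>BijGroup hyp3\<close>, that is, as bijections of the ball
  that are \<open>undefined\<close> outside it; equality of isometries is then equality of functions.
\<close>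

definition orientation_preserving_isometry :: "(real ^ 3 \<Rightarrow> real ^ 3) \<Rightarrow> bool"
  where "orientation_preserving_isometry g \<longleftrightarrow>
    g \<in> Bij hyp3 \<and>
    (\<forall>x\<in>hyp3. \<forall>y\<in>hyp3. hdist (g x) (g y) = hdist x y) \<and>
    (\<forall>x\<in>hyp3. \<exists>g'. (g has_derivative g') (at x) \<and> det (matrix g') > 0)"

text \<open>
  Discreteness refers to the topology of pointwise convergence, which on the isometries of
  hyperbolic space is the usual (compact-open, or Lie group) topology.
\<close>

definition kleinian_group :: "(real ^ 3 \<Rightarrow> real ^ 3) set \<Rightarrow> bool"
  where "kleinian_group G \<longleftrightarrow>
    subgroup G (BijGroup hyp3) \<and>
    (\<forall>g\<in>G. orientation_preserving_isometry g) \<and>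
    subtopology (product_topology (\<lambda>_. top_of_set hyp3) hyp3) G = discrete_topology G"

definition elliptic :: "(real ^ 3 \<Rightarrow> real ^ 3) \<Rightarrow> bool"
  where "elliptic g \<longleftrightarrow>
    orientation_preserving_isometry g \<and> (\<exists>x\<in>hyp3. g x \<noteq> x) \<and> (\<exists>x\<in>hyp3. g x = x)"

text \<open>
  A polyhedron is a subset of the open ball, so it does not contain its ideal vertices. Its faces
  and edges are the \<open>\<sigma>\<close> with \<open>\<sigma> facet_of P\<close> and the \<open>e\<close> with \<open>e edge_of P\<close>; an edge joining two
  ideal vertices is an open segment (a complete geodesic).
\<close>

definition convex_polyhedron :: "(real ^ 3) set \<Rightarrow> bool"
  where "convex_polyhedron P \<longleftrightarrow> (\<exists>Q. polyhedron Q \<and> P = Q \<inter> hyp3) \<and> interior P \<noteq> {}"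

text \<open>The Euclidean closure adds the points at infinity, so ideal vertices are included.\<close>

definition vertices :: "(real ^ 3) set \<Rightarrow> (real ^ 3) set"
  where "vertices P = {v. v extreme_point_of closure P}"

text \<open>
  By the Krein-Milman theorem, finiteness makes the closure of \<open>P\<close> the convex hull of its vertices.
  It excludes polyhedra of infinite volume, whose closure contains an open piece of the sphere.
\<close>

definition convex_ideal_polyhedron :: "(real ^ 3) set \<Rightarrow> bool"
  where "convex_ideal_polyhedron P \<longleftrightarrow>
    convex_polyhedron P \<and> finite (vertices P) \<and> vertices P \<subseteq> sphere 0 1"

text \<open>
  The angle, at a point \<open>x\<close> of the edge, between two geodesic segments that are perpendicular to the
  edge and run into the two faces meeting there. It depends neither on \<open>x\<close> nor on the segments.
\<close>

definition dihedral_angle :: "(real ^ 3) set \<Rightarrow> (real ^ 3) set \<Rightarrow> real"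
  where "dihedral_angle P e = (THE \<theta>. \<exists>\<sigma> \<tau> x y z.
    \<sigma> facet_of P \<and> \<tau> facet_of P \<and> \<sigma> \<noteq> \<tau> \<and> e \<subseteq> \<sigma> \<and> e \<subseteq> \<tau> \<and>
    x \<in> e \<and> y \<in> \<sigma> - e \<and> z \<in> \<tau> - e \<and>
    (\<forall>p\<in>e. hinner x (y - x) (p - x) = 0 \<and> hinner x (z - x) (p - x) = 0) \<and>
    \<theta> = hangle x (y - x) (z - x))"

text \<open>
  The function \<open>\<gamma>\<close> assigns to each face \<open>\<sigma>\<close> the transformation pairing it with the face
  \<open>\<sigma>' = \<gamma> \<sigma> ` \<sigma>\<close>. The condition that \<open>\<gamma> \<sigma>'\<close> is the inverse of \<open>\<gamma> \<sigma>\<close> says that \<open>\<sigma>'\<close> is in turn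
  paired with \<open>\<sigma>\<close>, so that the faces fall into disjoint pairs with one transformation (up to
  inversion) for each.
\<close>

definition fundamental_polyhedron ::
    "(real ^ 3 \<Rightarrow> real ^ 3) set \<Rightarrow> (real ^ 3) set \<Rightarrow>
     ((real ^ 3) set \<Rightarrow> real ^ 3 \<Rightarrow> real ^ 3) \<Rightarrow> bool"
  where "fundamental_polyhedron G P \<gamma> \<longleftrightarrow>
    convex_polyhedron P \<and>
    (\<forall>\<sigma>. \<sigma> facet_of P \<longrightarrow>
      \<gamma> \<sigma> \<in> G \<and>
      \<gamma> \<sigma> ` \<sigma> facet_of P \<and> \<gamma> \<sigma> ` \<sigma> \<noteq> \<sigma> \<and>
      \<gamma> \<sigma> ` P \<inter> P = \<gamma> \<sigma> ` \<sigma> \<and>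
      \<gamma> (\<gamma> \<sigma> ` \<sigma>) = inv\<^bsub>BijGroup hyp3\<^esub> (\<gamma> \<sigma>)) \<and>
    (\<Union>g\<in>G. g ` P) = hyp3 \<and>
    (\<forall>g\<in>G. \<forall>h\<in>G. g \<noteq> h \<longrightarrow> interior (g ` P) \<inter> interior (h ` P) = {}) \<and>
    generate (BijGroup hyp3) (\<gamma> ` {\<sigma>. \<sigma> facet_of P}) = G"

definition edge_pairing ::
    "(real ^ 3) set \<Rightarrow> ((real ^ 3) set \<Rightarrow> real ^ 3 \<Rightarrow> real ^ 3) \<Rightarrow> (real ^ 3) set rel"
  where "edge_pairing P \<gamma> = {(e, e'). e edge_of P \<and> e' edge_of P \<and>
    (\<exists>\<sigma>. \<sigma> facet_of P \<and> e \<subseteq> \<sigma> \<and> e' = \<gamma> \<sigma> ` e)}"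

definition edge_classes ::
    "(real ^ 3) set \<Rightarrow> ((real ^ 3) set \<Rightarrow> real ^ 3 \<Rightarrow> real ^ 3) \<Rightarrow> (real ^ 3) set set set"
  where "edge_classes P \<gamma> =
    {e. e edge_of P} //
      ((edge_pairing P \<gamma> \<union> (edge_pairing P \<gamma>)\<inverse>)\<^sup>* \<inter> {e. e edge_of P} \<times> {e. e edge_of P})"

end

theory Submission
  imports Defs
begin

text \<open>
  Summing the angle condition over the edge classes turns \<open>2 \<pi> E\<close> into the sum of the dihedral angles
  over all edges of \<open>P\<close>, since the classes partition the edges (\<open>sum_over_edge_classes\<close>). So everything
  rests on the identity \<open>\<Sum>\<^sub>e \<theta>(e) = \<pi> (E' - V')\<close> for an ideal polyhedron with \<open>E'\<close> edges and \<open>V'\<close>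
  vertices (\<open>sum_dihedral_angles\<close>). It follows from a local one: at a vertex \<open>v\<close> of degree \<open>n\<close> the
  dihedral angles sum to \<open>(n - 2) \<pi>\<close>, because the link of an ideal vertex is a Euclidean \<open>n\<close>-gon whose
  angles are the dihedral angles (\<open>sum_dihedral_angles_at_vertex\<close>). Adding this up over the vertices
  counts each edge at both of its ends.

  In the Klein model the link of \<open>v\<close> can be taken to be the section of the polyhedron by a Euclidean
  plane orthogonal to \<open>v\<close> that cuts off \<open>v\<close> from the other vertices. At the point \<open>x\<close> where an edge
  meets this plane, project the tangent vectors that are hyperbolically perpendicular to the edge
  along the edge to the plane. They arrive at the angle of the section at \<open>x\<close>, and the projection is
  conformal (\<open>hinner_perpendicular\<close>), as it is the vertical projection to a horizontal plane in the
  upper half-space with \<open>v\<close> at infinity. So the Euclidean angle of the section is the dihedral angle.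

  The angle sum of the polygon is obtained without ordering its vertices, by integral geometry.
  The angle at a vertex \<open>p\<close> is the measure of the set of those lines through \<open>p\<close>, parametrised by their
  angle in \<open>[0, \<pi>)\<close>, that contain a chord of the polygon (\<open>measure_double_wedge\<close>). For almost every
  direction of lines, all vertices but two have a chord in that direction, the exceptions being the
  two extremes of the projection along it (\<open>card_vertices_with_chord\<close>). Integration over the
  directions gives \<open>(n - 2) \<pi>\<close> (\<open>sum_chord_angles\<close>). This description also shows that the dihedral
  angle does not depend on the choices in its definition (\<open>dihedral_angle_eq_measure\<close>), as the set
  of chords makes no reference to them.
\<close>

section \<open>Directions in a Euclidean plane\<close>

definition orthonormal_pair :: "'a::real_inner \<Rightarrow> 'a \<Rightarrow> bool"
  where "orthonormal_pair a b \<longleftrightarrow> a \<bullet> a = 1 \<and> b \<bullet> b = 1 \<and> a \<bullet> b = 0"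

definition direction :: "'a::real_inner \<Rightarrow> 'a \<Rightarrow> real \<Rightarrow> 'a"
  where "direction a b \<theta> = cos \<theta> *\<^sub>R a + sin \<theta> *\<^sub>R b"

lemma inner_direction:
  assumes "orthonormal_pair a b"
  shows "direction a b s \<bullet> direction a b t = cos (t - s)"
  using assms
  by (simp add: orthonormal_pair_def direction_def inner_add_left inner_add_right cos_diff
      inner_commute[of b a])

lemma norm_direction:
  assumes "orthonormal_pair a b"
  shows "norm (direction a b s) = 1"
  using inner_direction[OF assms, of s s] by (simp add: norm_eq_sqrt_inner)

lemma direction_neq_0:
  assumes "orthonormal_pair a b"
  shows "direction a b s \<noteq> 0"
  using norm_direction[OF assms, of s] by auto

lemma direction_in_span: "direction a b s \<in> span {a, b}"
  unfolding direction_def by (intro span_add span_scale span_base) auto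

text \<open>The coefficients of a unit vector in the basis of two others are ratios of sines.\<close>

lemma sine_rule_direction:
  "sin (t - s) *\<^sub>R direction a b \<theta> =
    sin (t - \<theta>) *\<^sub>R direction a b s + sin (\<theta> - s) *\<^sub>R direction a b t"
proof -
  have 1: "sin (t - s) * cos \<theta> = sin (t - \<theta>) * cos s + sin (\<theta> - s) * cos t"
    by (simp add: sin_diff algebra_simps)
  have 2: "sin (t - s) * sin \<theta> = sin (t - \<theta>) * sin s + sin (\<theta> - s) * sin t"
    by (simp add: sin_diff algebra_simps)
  show ?thesis
    by (simp add: direction_def scaleR_add_right 1 2 scaleR_add_left)
qed

lemma polar_form_mod_sign:
  assumes ab: "orthonormal_pair a b" and d: "d \<in> span {a, b}" "d \<noteq> 0"
  obtains r s where "r \<noteq> 0" "0 \<le> s" "s < pi" "d = r *\<^sub>R direction a b s"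
proof -
  obtain \<alpha> \<beta> where d_eq: "d = \<alpha> *\<^sub>R a + \<beta> *\<^sub>R b"
  proof -
    obtain k where "d - k *\<^sub>R a \<in> span {b}"
      using d(1) span_breakdown_eq by blast
    then obtain l where "d - k *\<^sub>R a = l *\<^sub>R b"
      by (auto simp: span_singleton)
    then show ?thesis
      using that[of k l] by (simp add: algebra_simps)
  qed
  define R where "R = norm d"
  have R: "R > 0" using d(2) by (simp add: R_def)
  have "R\<^sup>2 = d \<bullet> d"
    by (simp add: R_def power2_norm_eq_inner)
  also have "\<dots> = \<alpha>\<^sup>2 + \<beta>\<^sup>2"
    using ab by (simp add: d_eq orthonormal_pair_def inner_add_left inner_add_right
        inner_commute[of b a] power2_eq_square)
  finally have "(\<alpha> / R)\<^sup>2 + (\<beta> / R)\<^sup>2 = 1"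
    using R by (auto simp: power_divide add_divide_distrib[symmetric] simp del: sum_power2_eq_zero_iff) 
  then obtain t where t: "0 \<le> t" "t < 2 * pi" "\<alpha> / R = cos t" "\<beta> / R = sin t"
    by (rule sincos_total_2pi)
  have d_t: "d = R *\<^sub>R direction a b t"
    using R by (simp add: d_eq direction_def scaleR_add_right flip: t(3,4))
  show ?thesis
  proof (cases "t < pi")
    case True
    then show ?thesis using that[of R t] R t d_t by simp
  next
    case False
    have "direction a b t = - direction a b (t - pi)"
      by (simp add: direction_def)
    then have "d = (- R) *\<^sub>R direction a b (t - pi)"
      using d_t by simp
    then show ?thesis using that[of "- R" "t - pi"] R t False by auto
  qed
qed

lemma lmeasurable_half_open_interval: "{x..<y::real} \<in> lmeasurable"
  by (rule bounded_set_imp_lmeasurable) auto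

text \<open>
  A line through the origin runs inside the double wedge spanned by \<open>d\<close> and \<open>d'\<close> iff its coefficients
  with respect to \<open>d\<close> and \<open>d'\<close> have equal signs. By the sine rule these are \<open>sin (s' - \<theta>)\<close> and
  \<open>sin (\<theta> - s)\<close> up to constant factors, where \<open>s < s'\<close> are the angles of the lines of \<open>d\<close> and \<open>d'\<close>. So the
  wedge is \<open>[s, s']\<close> or the complement of \<open>(s, s')\<close> in \<open>[0, \<pi>)\<close>. Lines rather than rays are used so
  that no case distinction modulo \<open>2 \<pi>\<close> arises.
\<close>

lemma measure_double_wedge:
  fixes a b d d' :: "'a::real_inner"
  assumes ab: "orthonormal_pair a b"
    and d: "d \<in> span {a, b}" and d': "d' \<in> span {a, b}"
    and indep: "\<And>\<alpha> \<beta>. \<alpha> *\<^sub>R d + \<beta> *\<^sub>R d' = 0 \<Longrightarrow> \<alpha> = 0 \<and> \<beta> = 0"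
  defines "W \<equiv> {\<theta>\<in>{0..<pi}. \<exists>\<alpha> \<beta>. direction a b \<theta> = \<alpha> *\<^sub>R d + \<beta> *\<^sub>R d' \<and> 0 \<le> \<alpha> * \<beta>}"
  shows "W \<in> lmeasurable" and "measure lebesgue W = arccos (d \<bullet> d' / (norm d * norm d'))"
proof -
  have main: "W \<in> lmeasurable \<and> measure lebesgue W = arccos (d \<bullet> d' / (norm d * norm d'))"
    if eq: "d = r *\<^sub>R direction a b s" "d' = r' *\<^sub>R direction a b s'"
      and r: "r \<noteq> 0" "r' \<noteq> 0" and s: "0 \<le> s" "s < s'" "s' < pi"
      and W: "W = {\<theta>\<in>{0..<pi}. \<exists>\<alpha> \<beta>. direction a b \<theta> = \<alpha> *\<^sub>R d + \<beta> *\<^sub>R d' \<and> 0 \<le> \<alpha> * \<beta>}"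
      and indep: "\<And>\<alpha> \<beta>. \<alpha> *\<^sub>R d + \<beta> *\<^sub>R d' = 0 \<Longrightarrow> \<alpha> = 0 \<and> \<beta> = 0"
    for d d' r r' s s'
  proof -
    have sn: "sin (s' - s) > 0" using s by (intro sin_gt_zero) auto
    have mem: "(\<exists>\<alpha> \<beta>. direction a b \<theta> = \<alpha> *\<^sub>R d + \<beta> *\<^sub>R d' \<and> 0 \<le> \<alpha> * \<beta>) \<longleftrightarrow>
        0 \<le> (r * r') * (sin (s' - \<theta>) * sin (\<theta> - s))" for \<theta>
    proof -
      define \<alpha>0 \<beta>0 where "\<alpha>0 = sin (s' - \<theta>) / (r * sin (s' - s))"
        and "\<beta>0 = sin (\<theta> - s) / (r' * sin (s' - s))"
      have "sin (s' - s) *\<^sub>R (\<alpha>0 *\<^sub>R d + \<beta>0 *\<^sub>R d') =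
          sin (s' - \<theta>) *\<^sub>R direction a b s + sin (\<theta> - s) *\<^sub>R direction a b s'"
        using r sn by (simp add: \<alpha>0_def \<beta>0_def eq scaleR_add_right)
      also have "\<dots> = sin (s' - s) *\<^sub>R direction a b \<theta>"
        by (rule sine_rule_direction[symmetric])
      finally have dir: "direction a b \<theta> = \<alpha>0 *\<^sub>R d + \<beta>0 *\<^sub>R d'"
        using sn by simp
      have uniq: "\<alpha> = \<alpha>0 \<and> \<beta> = \<beta>0" if "direction a b \<theta> = \<alpha> *\<^sub>R d + \<beta> *\<^sub>R d'" for \<alpha> \<beta>
        using indep[of "\<alpha> - \<alpha>0" "\<beta> - \<beta>0"] that dir by (simp add: algebra_simps)
      have "\<alpha>0 * \<beta>0 * ((r * sin (s' - s)) * (r' * sin (s' - s))) = sin (s' - \<theta>) * sin (\<theta> - s)"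
        using r sn by (simp add: \<alpha>0_def \<beta>0_def)
      then have eq0: "(r * r') * (sin (s' - \<theta>) * sin (\<theta> - s)) =
          \<alpha>0 * \<beta>0 * ((r * r')\<^sup>2 * (sin (s' - s))\<^sup>2)"
        by (simp add: power2_eq_square ac_simps)
      have "0 < (r * r')\<^sup>2 * (sin (s' - s))\<^sup>2"
        using r sn by simp
      then have "0 \<le> \<alpha>0 * \<beta>0 \<longleftrightarrow> 0 \<le> (r * r') * (sin (s' - \<theta>) * sin (\<theta> - s))"
        unfolding eq0 by (simp add: zero_le_mult_iff)
      then show ?thesis using uniq dir by metis
    qed
    have sign: "sin (s' - \<theta>) * sin (\<theta> - s) > 0 \<longleftrightarrow> s < \<theta> \<and> \<theta> < s'"
      "sin (s' - \<theta>) * sin (\<theta> - s) < 0 \<longleftrightarrow> \<theta> < s \<or> s' < \<theta>" if "\<theta> \<in> {0..<pi}" for \<theta>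
    proof -
      have p1: "sin (s' - \<theta>) > 0" if "\<theta> < s'"
        using that \<open>\<theta> \<in> {0..<pi}\<close> s by (intro sin_gt_zero) auto
      have p2: "sin (s' - \<theta>) < 0" if "\<theta> > s'"
        using that \<open>\<theta> \<in> {0..<pi}\<close> s sin_gt_zero[of "\<theta> - s'"] sin_minus[of "\<theta> - s'"] by auto
      have p3: "sin (\<theta> - s) > 0" if "\<theta> > s"
        using that \<open>\<theta> \<in> {0..<pi}\<close> s by (intro sin_gt_zero) auto
      have p4: "sin (\<theta> - s) < 0" if "\<theta> < s"
        using that \<open>\<theta> \<in> {0..<pi}\<close> s sin_gt_zero[of "s - \<theta>"] sin_minus[of "s - \<theta>"] by auto
      consider "\<theta> < s" | "\<theta> = s" | "s < \<theta>" "\<theta> < s'" | "\<theta> = s'" | "s' < \<theta>"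
        by linarith
      then have "(sin (s' - \<theta>) * sin (\<theta> - s) > 0 \<longleftrightarrow> s < \<theta> \<and> \<theta> < s') \<and>
          (sin (s' - \<theta>) * sin (\<theta> - s) < 0 \<longleftrightarrow> \<theta> < s \<or> s' < \<theta>)"
      proof cases
        case 1
        then have "sin (s' - \<theta>) * sin (\<theta> - s) < 0"
          using p1 p4 s by (intro mult_pos_neg) auto
        then show ?thesis using 1 s by linarith
      next
        case 3
        then have "sin (s' - \<theta>) * sin (\<theta> - s) > 0"
          using p1 p3 by (intro mult_pos_pos) auto
        then show ?thesis using 3 by linarith
      next
        case 5
        then have "sin (s' - \<theta>) * sin (\<theta> - s) < 0"
          using p2 p3 s by (intro mult_neg_pos) auto
        then show ?thesis using 5 s by linarith
      qed (use s in auto)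
      then show "sin (s' - \<theta>) * sin (\<theta> - s) > 0 \<longleftrightarrow> s < \<theta> \<and> \<theta> < s'"
        "sin (s' - \<theta>) * sin (\<theta> - s) < 0 \<longleftrightarrow> \<theta> < s \<or> s' < \<theta>" by auto
    qed
    have cosang: "d \<bullet> d' / (norm d * norm d') = sgn (r * r') * cos (s' - s)"
      using r by (simp add: eq norm_direction[OF ab] inner_direction[OF ab] sgn_mult real_sgn_eq abs_mult mult.commute)
    \<comment> \<open>If the signs differ, then \<open>d\<close> and \<open>d'\<close> span the supplementary angle of the two lines.\<close>
    show ?thesis
    proof (cases "r * r' > 0")
      case True
      have "W = {s..s'}"
      proof -
        have "0 \<le> (r * r') * (sin (s' - \<theta>) * sin (\<theta> - s)) \<longleftrightarrow> s \<le> \<theta> \<and> \<theta> \<le> s'"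
          if "\<theta> \<in> {0..<pi}" for \<theta>
        proof -
          have "0 \<le> (r * r') * (sin (s' - \<theta>) * sin (\<theta> - s)) \<longleftrightarrow> 0 \<le> sin (s' - \<theta>) * sin (\<theta> - s)"
            using mult_le_cancel_left_pos[OF True, of 0 "sin (s' - \<theta>) * sin (\<theta> - s)"]
            by (simp only: mult_zero_right)
          then show ?thesis using sign(2)[OF that] by (metis not_less)
        qed
        then have "W = {\<theta>\<in>{0..<pi}. s \<le> \<theta> \<and> \<theta> \<le> s'}"
          unfolding W mem by (intro Collect_cong conj_cong refl)
        then show ?thesis using s by auto
      qed
      moreover have "arccos (d \<bullet> d' / (norm d * norm d')) = s' - s"
        using True s by (simp add: cosang arccos_cos)
      ultimately show ?thesis using s by simp
    next
      case False
      then have neg: "r * r' < 0" using r by (simp add: less_le)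
      have "W = {0..<pi} - {s<..<s'}"
      proof -
        have "0 \<le> (r * r') * (sin (s' - \<theta>) * sin (\<theta> - s)) \<longleftrightarrow> \<not> (s < \<theta> \<and> \<theta> < s')"
          if "\<theta> \<in> {0..<pi}" for \<theta>
        proof -
          have "0 \<le> (r * r') * (sin (s' - \<theta>) * sin (\<theta> - s)) \<longleftrightarrow> sin (s' - \<theta>) * sin (\<theta> - s) \<le> 0"
            using mult_le_cancel_left_neg[OF neg, of 0 "sin (s' - \<theta>) * sin (\<theta> - s)"]
            by (simp only: mult_zero_right)
          then show ?thesis using sign(1)[OF that] by (metis not_less)
        qed
        then have "W = {\<theta>\<in>{0..<pi}. \<not> (s < \<theta> \<and> \<theta> < s')}"
          unfolding W mem by (intro Collect_cong conj_cong refl)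
        then show ?thesis by auto
      qed
      moreover have "measure lebesgue ({0..<pi} - {s<..<s'}) =
          measure lebesgue {0..<pi} - measure lebesgue {s<..<s'}"
        using s by (intro measurable_measure_Diff lmeasurable_half_open_interval) auto
      moreover have "{0..<pi} - {s<..<s'} \<in> lmeasurable"
        by (intro fmeasurable.Diff) (auto simp: lmeasurable_half_open_interval)
      moreover have "arccos (d \<bullet> d' / (norm d * norm d')) = pi - (s' - s)"
        using neg s by (simp add: cosang arccos_cos arccos_minus)
      ultimately show ?thesis using s by simp
    qed
  qed
  have "d \<noteq> 0" "d' \<noteq> 0" using indep[of 1 0] indep[of 0 1] by auto
  then obtain r s r' s' where r: "r \<noteq> 0" "r' \<noteq> 0" and s: "0 \<le> s" "s < pi" "0 \<le> s'" "s' < pi"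
    and eq: "d = r *\<^sub>R direction a b s" "d' = r' *\<^sub>R direction a b s'"
    using polar_form_mod_sign[OF ab d] polar_form_mod_sign[OF ab d'] by metis
  have "s \<noteq> s'"
  proof
    assume "s = s'"
    then have "r' *\<^sub>R d + (- r) *\<^sub>R d' = 0" by (simp add: eq)
    then show False using indep r by blast
  qed
  then consider "s < s'" | "s' < s" by linarith
  then have "W \<in> lmeasurable \<and> measure lebesgue W = arccos (d \<bullet> d' / (norm d * norm d'))"
  proof cases
    case 1
    then show ?thesis using main[OF eq r s(1) _ s(4) W_def[THEN meta_eq_to_obj_eq] indep] by blast
  next
    case 2
    have W': "W = {\<theta>\<in>{0..<pi}. \<exists>\<alpha> \<beta>. direction a b \<theta> = \<alpha> *\<^sub>R d' + \<beta> *\<^sub>R d \<and> 0 \<le> \<alpha> * \<beta>}"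
      unfolding W_def by (intro Collect_cong conj_cong refl) (metis add.commute mult.commute)
    have "W \<in> lmeasurable \<and> measure lebesgue W = arccos (d' \<bullet> d / (norm d' * norm d))"
      by (rule main[OF eq(2,1) r(2,1) s(3) 2 s(2) W']) (metis add.commute indep)
    then show ?thesis by (simp add: inner_commute mult.commute)
  qed
  then show "W \<in> lmeasurable" "measure lebesgue W = arccos (d \<bullet> d' / (norm d * norm d'))"
    by auto
qed

section \<open>The angle sum of a convex polygon\<close>

text \<open>
  For a convex set \<open>K\<close> and an extreme point \<open>x\<close>, this is the set of lines through \<open>x\<close> in the plane of \<open>a\<close>
  and \<open>b\<close> that enter \<open>K\<close>. The parameter \<open>t\<close> may be negative, so that half a turn is enough to see all
  rays. The set is also used for a point \<open>x\<close> inside an edge of a solid that is transverse to the plane.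
\<close>

definition chord_angles :: "'a::real_inner \<Rightarrow> 'a \<Rightarrow> 'a set \<Rightarrow> 'a \<Rightarrow> real set"
  where "chord_angles a b K x =
    {\<theta>\<in>{0..<pi}. \<exists>t. t \<noteq> 0 \<and> x + t *\<^sub>R direction a b \<theta> \<in> K}"

lemma direction_expansion:
  assumes ab: "orthonormal_pair a b" and d: "d \<in> span {a, b}"
  shows "d = (d \<bullet> direction a b \<theta>) *\<^sub>R direction a b \<theta> +
    (d \<bullet> direction a b (\<theta> + pi / 2)) *\<^sub>R direction a b (\<theta> + pi / 2)"
proof -
  let ?u = "direction a b \<theta>" and ?m = "direction a b (\<theta> + pi / 2)"
  have "?m \<bullet> ?u = 0" "?u \<bullet> ?m = 0"  "?u \<bullet> ?u = 1" "?m \<bullet> ?m = 1"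
    by (simp_all add: inner_direction[OF ab] cos_add)
  have m: "?m = (- sin \<theta>) *\<^sub>R a + cos \<theta> *\<^sub>R b"
    by (simp add: direction_def sin_add cos_add)
  have one: "cos \<theta> * cos \<theta> + sin \<theta> * sin \<theta> = 1"
    using sin_cos_squared_add3 by blast
  have "cos \<theta> *\<^sub>R ?u - sin \<theta> *\<^sub>R ?m = (cos \<theta> * cos \<theta> + sin \<theta> * sin \<theta>) *\<^sub>R a"
    unfolding m by (simp add: direction_def algebra_simps del: sin_cos_squared_add3)
  then have 1: "cos \<theta> *\<^sub>R ?u - sin \<theta> *\<^sub>R ?m = a" by (simp only: one scaleR_one)
  have "sin \<theta> *\<^sub>R ?u + cos \<theta> *\<^sub>R ?m = (cos \<theta> * cos \<theta> + sin \<theta> * sin \<theta>) *\<^sub>R b"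
    unfolding m by (simp add: direction_def algebra_simps del: sin_cos_squared_add3)
  then have 2: "sin \<theta> *\<^sub>R ?u + cos \<theta> *\<^sub>R ?m = b" by (simp only: one scaleR_one)
  have "cos \<theta> *\<^sub>R ?u - sin \<theta> *\<^sub>R ?m \<in> span {?u, ?m}" "sin \<theta> *\<^sub>R ?u + cos \<theta> *\<^sub>R ?m \<in> span {?u, ?m}"
    by (intro span_add span_diff span_scale span_base; simp)+
  then have "{a, b} \<subseteq> span {?u, ?m}" unfolding 1 2 by simp
  then have "d \<in> span {?u, ?m}"
    using d span_minimal[OF _ subspace_span] by blast
  then obtain k where "d - k *\<^sub>R ?u \<in> span {?m}"
    using span_breakdown_eq by blast
  then obtain l where "d - k *\<^sub>R ?u = l *\<^sub>R ?m"
    by (auto simp: span_singleton)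
  then have eq: "d = k *\<^sub>R ?u + l *\<^sub>R ?m" by (simp add: algebra_simps)
  have "d \<bullet> ?u = k" "d \<bullet> ?m = l"
    using \<open>?m \<bullet> ?u = 0\<close> \<open>?u \<bullet> ?m = 0\<close> \<open>?u \<bullet> ?u = 1\<close> \<open>?m \<bullet> ?m = 1\<close>
    by (simp_all add: eq inner_add_left)
  then show ?thesis using eq by simp
qed

text \<open>
  The points where \<open>m\<close> is maximal form a face, which is the hull of extreme points of \<open>C\<close>; only \<open>p\<close> is
  available for it.
\<close>

lemma unique_maximum_at_extreme_point:
  fixes C :: "'a::euclidean_space set"
  assumes C: "compact C" "convex C" and p: "p extreme_point_of C"
    and max: "\<And>q. q extreme_point_of C \<Longrightarrow> q \<noteq> p \<Longrightarrow> m \<bullet> q < m \<bullet> p"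
    and x: "x \<in> C" "m \<bullet> x = m \<bullet> p"
  shows "x = p"
proof -
  have hull: "C = convex hull {x. x extreme_point_of C}"
    by (rule Krein_Milman_Minkowski[OF C])
  have "convex hull {x. x extreme_point_of C} \<subseteq> {x. m \<bullet> x \<le> m \<bullet> p}"
    by (rule hull_minimal) (use max in \<open>auto simp: convex_halfspace_le intro: less_imp_le\<close>)
  then have le: "m \<bullet> x \<le> m \<bullet> p" if "x \<in> C" for x using hull that by blast
  define F where "F = C \<inter> {x. m \<bullet> x = m \<bullet> p}"
  have F: "F face_of C"
    unfolding F_def by (rule face_of_Int_supporting_hyperplane_le[OF C(2) le])
  have "{x. x extreme_point_of F} \<subseteq> {p}"
    using extreme_point_of_face[OF F] max by (force simp: F_def)
  moreover have "F = convex hull {x. x extreme_point_of F}"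
    by (rule Krein_Milman_Minkowski[OF face_of_imp_compact[OF C(2,1) F] face_of_imp_convex[OF F]])
  ultimately have "F \<subseteq> convex hull {p}" by (metis hull_mono)
  then show ?thesis using x by (auto simp: F_def)
qed

text \<open>
  Project a polygon along a direction parallel to none of its sides or diagonals. The image is a
  segment, each of whose end points is the image of a single vertex. These two vertices are the
  only ones without a chord in the given direction.
\<close>

lemma card_vertices_with_chord:
  fixes C :: "'a::euclidean_space set"
  assumes ab: "orthonormal_pair a b"
    and C: "compact C" "convex C" and plane: "\<And>x y. x \<in> C \<Longrightarrow> y \<in> C \<Longrightarrow> x - y \<in> span {a, b}"
    and X: "X = {p. p extreme_point_of C}" "finite X" "2 \<le> card X"
    and generic: "\<And>p q. p \<in> X \<Longrightarrow> q \<in> X \<Longrightarrow> p \<noteq> q \<Longrightarrow> (p - q) \<bullet> direction a b (\<theta> + pi / 2) \<noteq> 0"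
  shows "card {p\<in>X. \<exists>t. t \<noteq> 0 \<and> p + t *\<^sub>R direction a b \<theta> \<in> C} + 2 = card X"
proof -
  define u m where "u = direction a b \<theta>" and "m = direction a b (\<theta> + pi / 2)"
  have um: "m \<bullet> u = 0"
    by (simp add: u_def m_def inner_direction[OF ab] cos_add)
  have u0: "u \<noteq> 0" by (simp add: u_def direction_neq_0[OF ab])
  have gen: "m \<bullet> p \<noteq> m \<bullet> q" if "p \<in> X" "q \<in> X" "p \<noteq> q" for p q
    using generic[OF that] by (simp add: m_def inner_diff_left inner_commute)
  have XC: "X \<subseteq> C" by (auto simp: X extreme_point_of_def)
  have ne: "X \<noteq> {}" using X(3) by auto
  have "Max ((\<lambda>q. m \<bullet> q) ` X) \<in> (\<lambda>q. m \<bullet> q) ` X" "Min ((\<lambda>q. m \<bullet> q) ` X) \<in> (\<lambda>q. m \<bullet> q) ` X"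
    using X ne by auto
  then obtain p1 p0 where p1: "p1 \<in> X" "m \<bullet> p1 = Max ((\<lambda>q. m \<bullet> q) ` X)"
    and p0: "p0 \<in> X" "m \<bullet> p0 = Min ((\<lambda>q. m \<bullet> q) ` X)" by auto
  have p1_max: "m \<bullet> q < m \<bullet> p1" if "q \<in> X" "q \<noteq> p1" for q
  proof -
    have "m \<bullet> q \<le> m \<bullet> p1" using X that p1 by auto
    then show ?thesis using gen[OF that(1) p1(1) that(2)] by simp
  qed
  have p0_min: "m \<bullet> p0 < m \<bullet> q" if "q \<in> X" "q \<noteq> p0" for q
  proof -
    have "m \<bullet> p0 \<le> m \<bullet> q" using X that p0 by auto
    then show ?thesis using gen[OF that(1) p0(1) that(2)] by simp
  qed
  have "X \<noteq> {p1}" using X(3) by auto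
  then obtain q where "q \<in> X" "q \<noteq> p1" using p1 by auto
  then have neq: "p0 \<noteq> p1" using p1_max p0_min by force
  have no1: "\<not> (\<exists>t. t \<noteq> 0 \<and> p1 + t *\<^sub>R u \<in> C)"
  proof clarify
    fix t assume t: "t \<noteq> 0" "p1 + t *\<^sub>R u \<in> C"
    have "p1 + t *\<^sub>R u = p1"
      by (rule unique_maximum_at_extreme_point[OF C _ _ t(2), where m = m])
        (use p1 p1_max um in \<open>auto simp: X inner_add_right\<close>)
    then show False using t u0 by simp
  qed
  have no0: "\<not> (\<exists>t. t \<noteq> 0 \<and> p0 + t *\<^sub>R u \<in> C)"
  proof clarify
    fix t assume t: "t \<noteq> 0" "p0 + t *\<^sub>R u \<in> C"
    have "p0 + t *\<^sub>R u = p0"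
      by (rule unique_maximum_at_extreme_point[OF C _ _ t(2), where m = "- m"])
        (use p0 p0_min um in \<open>auto simp: X inner_add_right\<close>)
    then show False using t u0 by simp
  qed
  have yes: "\<exists>t. t \<noteq> 0 \<and> p + t *\<^sub>R u \<in> C" if p: "p \<in> X" "p \<noteq> p0" "p \<noteq> p1" for p
  proof -
    have h: "m \<bullet> p0 < m \<bullet> p" "m \<bullet> p < m \<bullet> p1" using p0_min p1_max p by auto
    define s where "s = (m \<bullet> p - m \<bullet> p0) / (m \<bullet> p1 - m \<bullet> p0)"
    have s: "0 < s" "s < 1" using h by (auto simp: s_def)
    define z where "z = (1 - s) *\<^sub>R p0 + s *\<^sub>R p1"
    have z: "z \<in> open_segment p0 p1"
      using s neq by (auto simp: in_segment z_def)
    have zC: "z \<in> C"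
      unfolding z_def using C(2) XC p0 p1 s by (intro convexD_alt) auto
    have "m \<bullet> z = m \<bullet> p0 + s * (m \<bullet> p1 - m \<bullet> p0)"
      by (simp add: z_def inner_add_right algebra_simps)
    also have "\<dots> = m \<bullet> p" using h by (simp add: s_def)
    finally have "(z - p) \<bullet> m = 0" by (simp add: inner_commute[of _ m] inner_diff_right)
    have "z - p = ((z - p) \<bullet> u) *\<^sub>R u + ((z - p) \<bullet> m) *\<^sub>R m"
      unfolding u_def m_def by (rule direction_expansion[OF ab plane[OF zC]]) (use p XC in blast)
    also have "\<dots> = ((z - p) \<bullet> u) *\<^sub>R u"
      using \<open>(z - p) \<bullet> m = 0\<close> by simp
    finally obtain t where t: "z = p + t *\<^sub>R u"
      by (metis add.commute diff_add_cancel)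
    have "z \<noteq> p"
      using p z p0 p1 XC by (auto simp: X extreme_point_of_def)
    then have "t \<noteq> 0" using t by auto
    then show ?thesis using t zC by blast
  qed
  have "{p\<in>X. \<exists>t. t \<noteq> 0 \<and> p + t *\<^sub>R u \<in> C} = X - {p0, p1}"
    using no0 no1 yes by blast
  moreover have "card (X - {p0, p1}) = card X - 2"
    using X(2) p0(1) p1(1) neq by (subst card_Diff_subset) auto
  ultimately show ?thesis using X(3) by (simp add: u_def)
qed

text \<open>
  Integrate the count of vertices with a chord over all directions. It fails only for the finitely
  many directions of sides and diagonals.
\<close>

lemma sum_chord_angles:
  fixes C :: "'a::euclidean_space set"
  assumes ab: "orthonormal_pair a b"
    and C: "compact C" "convex C" and plane: "\<And>x y. x \<in> C \<Longrightarrow> y \<in> C \<Longrightarrow> x - y \<in> span {a, b}"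
    and X: "X = {p. p extreme_point_of C}" "finite X" "2 \<le> card X"
    and meas: "\<And>p. p \<in> X \<Longrightarrow> chord_angles a b C p \<in> lmeasurable"
  shows "(\<Sum>p\<in>X. measure lebesgue (chord_angles a b C p)) = pi * (real (card X) - 2)"
proof -
  define B where "B p q = {\<theta>\<in>{0..<pi}. (p - q) \<bullet> direction a b (\<theta> + pi / 2) = 0}" for p q
  have B: "finite (B p q)" if "p \<in> X" "q \<in> X" "p \<noteq> q" for p q
  proof -
    have "p - q \<in> span {a, b}" "p - q \<noteq> 0"
      using that by (auto simp: X extreme_point_of_def intro: plane)
    then obtain r s where rs: "r \<noteq> 0" "0 \<le> s" "s < pi" "p - q = r *\<^sub>R direction a b s"
      by (rule polar_form_mod_sign[OF ab])
    have "\<theta> = s" if "\<theta> \<in> B p q" for \<theta>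
    proof -
      have "(p - q) \<bullet> direction a b (\<theta> + pi / 2) = 0"
        using that by (simp only: B_def mem_Collect_eq)
      then have "cos (\<theta> + pi / 2 - s) = 0"
        using rs(1) by (simp only: rs(4) inner_scaleR_left inner_direction[OF ab] mult_eq_0_iff) simp
      then have "cos ((\<theta> - s) + pi / 2) = 0"
        by (simp add: add_diff_eq diff_add_eq)
      moreover have "cos ((\<theta> - s) + pi / 2) = - sin (\<theta> - s)"
        unfolding cos_add cos_pi_half sin_pi_half by simp
      ultimately have "sin (\<theta> - s) = 0"
        by linarith
      moreover have "- pi < \<theta> - s" "\<theta> - s < pi"
        using that rs(2,3) by (simp_all add: B_def)
      ultimately have "\<theta> - s = 0" by (metis sin_eq_0_pi)
      then show ?thesis by simp
    qed
    then have "B p q \<subseteq> {s}" by blast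
    then show ?thesis using finite_subset by blast
  qed
  define N where "N = (\<Union>(p, q)\<in>{(p, q). p \<in> X \<and> q \<in> X \<and> p \<noteq> q}. B p q)"
  have "finite {(p, q). p \<in> X \<and> q \<in> X \<and> p \<noteq> q}"
    by (rule finite_subset[of _ "X \<times> X"]) (use X(2) in auto)
  then have N: "finite N"
    unfolding N_def by (rule finite_UN_I) (use B in auto)
  have count: "(real (card X) - 2) * indicator {0..<pi} \<theta> = (\<Sum>p\<in>X. indicator (chord_angles a b C p) \<theta>)"
    if "\<theta> \<notin> N" for \<theta>
  proof (cases "\<theta> \<in> {0..<pi}")
    case True
    have gen: "(p - q) \<bullet> direction a b (\<theta> + pi / 2) \<noteq> 0" if "p \<in> X" "q \<in> X" "p \<noteq> q" for p q
    proof -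
      have "\<theta> \<notin> B p q" using \<open>\<theta> \<notin> N\<close> that unfolding N_def by blast
      then show ?thesis using True by (simp add: B_def)
    qed
    have "card {p\<in>X. \<exists>t. t \<noteq> 0 \<and> p + t *\<^sub>R direction a b \<theta> \<in> C} + 2 = card X"
      by (rule card_vertices_with_chord[OF ab C plane X gen])
    moreover have "{p\<in>X. \<theta> \<in> chord_angles a b C p} =
        {p\<in>X. \<exists>t. t \<noteq> 0 \<and> p + t *\<^sub>R direction a b \<theta> \<in> C}"
      unfolding chord_angles_def using True by blast
    moreover have "(\<Sum>p\<in>X. indicator (chord_angles a b C p) \<theta> :: real) =
        (\<Sum>p\<in>X. of_bool (\<theta> \<in> chord_angles a b C p))"
      by (intro sum.cong refl) (simp add: indicator_def)
    moreover have "\<dots> = real (card (X \<inter> {p. \<theta> \<in> chord_angles a b C p}))"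
      using X(2) by (simp only: sum_of_bool_eq)
    moreover have "X \<inter> {p. \<theta> \<in> chord_angles a b C p} = {p\<in>X. \<theta> \<in> chord_angles a b C p}"
      by blast
    moreover have "real (card X) - 2 = real n" if "n + 2 = card X" for n
      using that by linarith
    ultimately show ?thesis using True by simp
  next
    case False
    then show ?thesis by (auto simp: chord_angles_def)
  qed
  have 0: "((\<lambda>\<theta>. \<Sum>p\<in>X. indicator (chord_angles a b C p) \<theta>) has_integral
      (\<Sum>p\<in>X. measure lebesgue (chord_angles a b C p))) UNIV"
    using meas X by (intro has_integral_sum) (auto simp: lmeasurable_iff_has_integral)
  have 1: "((\<lambda>\<theta>. (real (card X) - 2) * indicator {0..<pi} \<theta>) has_integral
      (\<Sum>p\<in>X. measure lebesgue (chord_angles a b C p))) UNIV"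
    by (rule has_integral_spike_finite[OF N _ 0]) (rule count, blast)
  have "{0..<pi} \<in> lmeasurable" by (rule lmeasurable_half_open_interval)
  then have "((\<lambda>\<theta>. (real (card X) - 2) * indicator {0..<pi} \<theta>) has_integral
      (real (card X) - 2) * pi) UNIV"
    unfolding lmeasurable_iff_has_integral by (intro has_integral_mult_right) simp
  with 1 show ?thesis using has_integral_unique by (metis mult.commute)
qed

section \<open>Hyperbolic angles seen from an ideal point\<close>

lemma hinner_scaleR_right: "hinner x u (c *\<^sub>R w) = c * hinner x u w"
  by (simp add: hinner_def add_divide_distrib algebra_simps)

lemma hinner_add_left: "hinner x (u + u') w = hinner x u w + hinner x u' w"
  by (simp add: hinner_def inner_add_left inner_add_right add_divide_distrib algebra_simps)

lemma hinner_scaleR_left: "hinner x (c *\<^sub>R u) w = c * hinner x u w"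
  by (simp add: hinner_def add_divide_distrib algebra_simps)

lemma hyp3_iff: "x \<in> hyp3 \<longleftrightarrow> x \<bullet> x < 1"
  by (simp add: hyp3_def norm_eq_sqrt_inner)

lemma hinner_pos:
  assumes "x \<in> hyp3" "u \<noteq> 0"
  shows "hinner x u u > 0"
proof -
  have "(u \<bullet> u) / (1 - x \<bullet> x) > 0" using assms by (simp add: hyp3_iff)
  moreover have "((x \<bullet> u) * (x \<bullet> u)) / (1 - x \<bullet> x)\<^sup>2 \<ge> 0" by simp
  ultimately show ?thesis unfolding hinner_def by (rule add_pos_nonneg)
qed

lemma inner_sphere_less_1:
  fixes v :: "'a::real_inner"
  assumes "norm v = 1" "norm x \<le> 1" "x \<noteq> v"
  shows "x \<bullet> v < 1"
proof -
  have "0 < (x - v) \<bullet> (x - v)" using assms by simp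
  also have "\<dots> = x \<bullet> x + v \<bullet> v - 2 * (x \<bullet> v)"
    by (simp add: inner_diff_left inner_diff_right inner_commute)
  also have "\<dots> \<le> 2 - 2 * (x \<bullet> v)"
  proof -
    have "x \<bullet> x \<le> 1" using assms(2) by (simp add: norm_eq_sqrt_inner)
    moreover have "v \<bullet> v = 1" using assms(1) by (simp add: norm_eq_sqrt_inner)
    ultimately show ?thesis by simp
  qed
  finally show ?thesis by simp
qed

text \<open>
  In the upper half-space with the ideal point \<open>v\<close> at infinity, the lines through \<open>v\<close> are vertical
  and the metric is conformal to the Euclidean one. In the Klein model this says: for tangent
  vectors at \<open>x\<close> that are perpendicular to the line through \<open>x\<close> and \<open>v\<close>, the hyperbolic angle is
  the Euclidean angle of their projections, along that line, to the plane orthogonal to \<open>v\<close>.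
\<close>

definition horospheric_projection :: "real ^ 3 \<Rightarrow> real ^ 3 \<Rightarrow> real ^ 3 \<Rightarrow> real ^ 3"
  where "horospheric_projection v x u = u + ((u \<bullet> v) / (1 - x \<bullet> v)) *\<^sub>R (x - v)"

lemma inner_horospheric_projection_eq_0:
  assumes "norm v = 1" "x \<bullet> v \<noteq> 1"
  shows "horospheric_projection v x u \<bullet> v = 0"
proof -
  have "v \<bullet> v = 1" using assms(1) by (simp add: norm_eq_sqrt_inner)
  define k where "k = (u \<bullet> v) / (1 - x \<bullet> v)"
  have "horospheric_projection v x u \<bullet> v = u \<bullet> v - k * (1 - x \<bullet> v)"
    using \<open>v \<bullet> v = 1\<close>
    by (simp add: horospheric_projection_def inner_add_left inner_diff_left algebra_simps flip: k_def)
  also have "\<dots> = 0" using assms(2) by (simp add: k_def)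
  finally show ?thesis .
qed

lemma hinner_perpendicular:
  assumes v: "norm v = 1" and x: "x \<in> hyp3"
    and u: "hinner x u (v - x) = 0" "hinner x u' (v - x) = 0"
  shows "hinner x u u' =
    (horospheric_projection v x u \<bullet> horospheric_projection v x u') / (1 - x \<bullet> x)"
proof -
  \<comment> \<open>The height of \<open>x\<close> in the half-space is \<open>sqrt q / w\<close> up to scaling. A vector is perpendicular to
    the line iff the height is stationary along it, which ties \<open>s \<bullet> x\<close> to \<open>s \<bullet> v\<close>.\<close>
  define q w where "q = 1 - x \<bullet> x" and "w = 1 - x \<bullet> v"
  have q: "q > 0" using x by (simp add: q_def hyp3_iff)
  have "norm x < 1" using x by (simp add: hyp3_def)
  then have w: "w > 0" using inner_sphere_less_1[OF v, of x] v by (force simp: w_def)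
  define k k' where "k = (u \<bullet> v) / w" and "k' = (u' \<bullet> v) / w"
  have vv: "v \<bullet> v = 1" using v by (simp add: norm_eq_sqrt_inner)
  have perp: "s \<bullet> v = k * w" "s \<bullet> x = q * k" if "hinner x s (v - x) = 0" "k = (s \<bullet> v) / w" for s k
  proof -
    show kw: "s \<bullet> v = k * w" using that(2) w by simp
    have "hinner x s (v - x) = (s \<bullet> v - s \<bullet> x) / q + (s \<bullet> x) * (q - w) / q\<^sup>2"
      by (simp add: hinner_def q_def w_def inner_diff_right inner_commute)
    also have "\<dots> = ((s \<bullet> v) * q - (s \<bullet> x) * w) / q\<^sup>2"
      using q by (simp add: field_simps power2_eq_square)
    finally have "(s \<bullet> v) * q = (s \<bullet> x) * w" using that(1) q by simp
    then show "s \<bullet> x = q * k" using kw w by (simp add: mult.commute)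
  qed
  note p = perp[OF u(1) k_def] perp[OF u(2) k'_def]
  have xx: "(x - v) \<bullet> (x - v) = 2 * w - q"
    by (simp add: q_def w_def vv inner_diff_left inner_diff_right inner_commute)
  have "horospheric_projection v x u \<bullet> horospheric_projection v x u' =
      (u + k *\<^sub>R (x - v)) \<bullet> (u' + k' *\<^sub>R (x - v))"
    by (simp add: horospheric_projection_def k_def k'_def w_def)
  also have "\<dots> = u \<bullet> u' + k' * (u \<bullet> (x - v)) + k * (u' \<bullet> (x - v)) + k * k' * ((x - v) \<bullet> (x - v))"
    by (simp add: inner_add_left inner_add_right inner_commute algebra_simps)
  also have "\<dots> = u \<bullet> u' + q * (k * k')"
    unfolding xx by (simp add: inner_diff_right p algebra_simps)
  finally have eq: "horospheric_projection v x u \<bullet> horospheric_projection v x u' = u \<bullet> u' + q * (k * k')" .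
  have "hinner x u u' = (u \<bullet> u') / q + (q * k) * (q * k') / q\<^sup>2"
    using p by (simp add: hinner_def q_def inner_commute)
  also have "\<dots> = (u \<bullet> u' + q * (k * k')) / q"
    using q by (simp add: field_simps power2_eq_square)
  finally show ?thesis unfolding eq by (simp add: q_def)
qed

lemma hangle_perpendicular:
  assumes v: "norm v = 1" and x: "x \<in> hyp3"
    and u: "hinner x u (v - x) = 0" "hinner x u' (v - x) = 0"
  defines "d \<equiv> horospheric_projection v x u" and "d' \<equiv> horospheric_projection v x u'"
  shows "hangle x u u' = arccos (d \<bullet> d' / (norm d * norm d'))"
proof -
  have q: "1 - x \<bullet> x > 0" using x by (simp add: hyp3_iff)
  have "sqrt (hinner x u u) * sqrt (hinner x u' u') = norm d * norm d' / (1 - x \<bullet> x)"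
    using q by (simp add: hinner_perpendicular[OF v x u(1) u(1)] hinner_perpendicular[OF v x u(2) u(2)]
        real_sqrt_divide norm_eq_sqrt_inner d_def d'_def)
  then show ?thesis
    using q by (simp add: hangle_def hinner_perpendicular[OF v x u] d_def d'_def)
qed

section \<open>The chords of a wedge\<close>

text \<open>
  The multiple of \<open>g\<close>, the direction of the edge, comes for free: first move \<open>x\<close> along the edge, then
  take a convex combination with \<open>y\<close> and \<open>z\<close>.
\<close>

lemma feasible_direction:
  fixes S :: "'a::euclidean_space set"
  assumes S: "convex S" "y \<in> S" "z \<in> S"
    and g: "0 < \<rho>" "\<And>r. \<bar>r\<bar> \<le> \<rho> \<Longrightarrow> x + r *\<^sub>R g \<in> S"
    and AB: "0 \<le> A" "0 \<le> B"
  obtains \<epsilon> where "0 < \<epsilon>" "x + \<epsilon> *\<^sub>R (A *\<^sub>R (y - x) + B *\<^sub>R (z - x) + \<gamma> *\<^sub>R g) \<in> S"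
proof -
  define \<epsilon> where "\<epsilon> = min (1 / (2 * (A + B + 1))) (\<rho> / (2 * (\<bar>\<gamma>\<bar> + 1)))"
  have e0: "0 < \<epsilon>" using AB g(1) by (simp add: \<epsilon>_def)
  define \<eta> where "\<eta> = \<epsilon> * (A + B)"
  have "\<epsilon> * (2 * (A + B + 1)) \<le> 1"
  proof -
    have "\<epsilon> \<le> 1 / (2 * (A + B + 1))" by (simp add: \<epsilon>_def)
    then show ?thesis using AB by (simp add: pos_le_divide_eq)
  qed
  then have \<eta>: "0 \<le> \<eta>" "\<eta> \<le> 1 / 2" using AB e0 by (auto simp: \<eta>_def algebra_simps)
  have "\<epsilon> * (2 * (\<bar>\<gamma>\<bar> + 1)) \<le> \<rho>"
  proof -
    have "\<epsilon> \<le> \<rho> / (2 * (\<bar>\<gamma>\<bar> + 1))" by (simp add: \<epsilon>_def)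
    moreover have "2 * (\<bar>\<gamma>\<bar> + 1) > 0" by simp
    ultimately show ?thesis by (simp only: pos_le_divide_eq)
  qed
  then have \<gamma>: "2 * (\<epsilon> * \<bar>\<gamma>\<bar>) \<le> \<rho>" using e0 by (simp add: algebra_simps)
  define r where "r = \<epsilon> * \<gamma> / (1 - \<eta>)"
  have "\<bar>r\<bar> = \<epsilon> * \<bar>\<gamma>\<bar> / (1 - \<eta>)" using \<eta> e0 by (simp add: r_def abs_mult)
  also have "\<dots> \<le> \<epsilon> * \<bar>\<gamma>\<bar> / (1 / 2)" using \<eta> e0 by (intro divide_left_mono) auto
  also have "\<dots> \<le> \<rho>" using \<gamma> by simp
  finally have p: "x + r *\<^sub>R g \<in> S" by (rule g(2))
  have "(1 - \<eta>) *\<^sub>R (x + r *\<^sub>R g) + (\<epsilon> * A) *\<^sub>R y + (\<epsilon> * B) *\<^sub>R z \<in> convex hull {x + r *\<^sub>R g, y, z}"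
  proof -
    have "0 \<le> 1 - \<eta>" "0 \<le> \<epsilon> * A" "0 \<le> \<epsilon> * B" "(1 - \<eta>) + \<epsilon> * A + \<epsilon> * B = 1"
      using \<eta> e0 AB by (auto simp: \<eta>_def algebra_simps)
    then show ?thesis unfolding convex_hull_3 by blast
  qed
  moreover have "convex hull {x + r *\<^sub>R g, y, z} \<subseteq> S"
    by (rule hull_minimal) (use p S in auto)
  moreover have "(1 - \<eta>) *\<^sub>R (x + r *\<^sub>R g) + (\<epsilon> * A) *\<^sub>R y + (\<epsilon> * B) *\<^sub>R z =
      x + \<epsilon> *\<^sub>R (A *\<^sub>R (y - x) + B *\<^sub>R (z - x) + \<gamma> *\<^sub>R g)"
  proof -
    have "(1 - \<eta>) * r = \<epsilon> * \<gamma>" using \<eta> by (simp add: r_def)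
    then have "(1 - \<eta>) *\<^sub>R (x + r *\<^sub>R g) = (1 - \<eta>) *\<^sub>R x + (\<epsilon> * \<gamma>) *\<^sub>R g"
      by (simp add: scaleR_add_right)
    also have "(1 - \<eta>) *\<^sub>R x = x - (\<epsilon> * A) *\<^sub>R x - (\<epsilon> * B) *\<^sub>R x"
      by (simp add: \<eta>_def algebra_simps)
    finally have *: "(1 - \<eta>) *\<^sub>R (x + r *\<^sub>R g) =
      x - (\<epsilon> * A) *\<^sub>R x - (\<epsilon> * B) *\<^sub>R x + (\<epsilon> * \<gamma>) *\<^sub>R g" .
    show ?thesis unfolding * by (simp add: algebra_simps)
  qed
  ultimately show ?thesis using that e0 by auto
qed

lemma open_segment_moves:
  fixes x :: "'a::real_vector"
  assumes x: "x \<in> open_segment v w"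
  obtains \<rho> where "0 < \<rho>" "\<And>r. \<bar>r\<bar> \<le> \<rho> \<Longrightarrow> x + r *\<^sub>R (x - v) \<in> open_segment v w"
proof -
  obtain s where s: "0 < s" "s < 1" "x = (1 - s) *\<^sub>R v + s *\<^sub>R w" and vw: "v \<noteq> w"
    using x by (auto simp: in_segment)
  define \<rho> where "\<rho> = min (1 / 2) ((1 - s) / (2 * s))"
  have "x + r *\<^sub>R (x - v) \<in> open_segment v w" if "\<bar>r\<bar> \<le> \<rho>" for r
  proof -
    have r: "\<bar>r\<bar> \<le> 1 / 2" "\<bar>r\<bar> \<le> (1 - s) / (2 * s)" using that by (auto simp: \<rho>_def)
    have pos: "0 < (1 + r) * s" using r s by (intro mult_pos_pos) auto
    have "\<bar>r\<bar> * (2 * s) \<le> 1 - s" using r(2) s by (simp add: pos_le_divide_eq)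
    then have "2 * (\<bar>r\<bar> * s) \<le> 1 - s" by (simp add: algebra_simps)
    then have "\<bar>r\<bar> * s < 1 - s" using s by linarith
    moreover have "r * s \<le> \<bar>r\<bar> * s" using s by (intro mult_right_mono) auto
    ultimately have "r * s < 1 - s" by linarith
    then have "(1 + r) * s < 1" by (simp add: algebra_simps)
    moreover have "x + r *\<^sub>R (x - v) = (1 - (1 + r) * s) *\<^sub>R v + ((1 + r) * s) *\<^sub>R w"
      by (simp add: s algebra_simps)
    ultimately show ?thesis using vw pos by (auto simp: in_segment)
  qed
  moreover have "0 < \<rho>" using s by (simp add: \<rho>_def)
  ultimately show ?thesis using that by blast
qed

text \<open>
  A chord at \<open>x\<close> is moved to a parallel chord at \<open>x'\<close> by the homothety that is centred at an end of the
  segment and takes \<open>x\<close> to \<open>x'\<close>, with the end chosen such that it contracts.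
\<close>

lemma chord_angles_constant_on_segment:
  assumes K: "convex K" "v \<in> K" "w \<in> K"
    and x: "x \<in> open_segment v w" "x' \<in> open_segment v w"
  shows "chord_angles a b K x = chord_angles a b K x'"
proof -
  have *: "\<exists>t. t \<noteq> 0 \<and> x' + t *\<^sub>R u \<in> K"
    if x: "x \<in> open_segment v w" "x' \<in> open_segment v w" and t: "t \<noteq> 0" "x + t *\<^sub>R u \<in> K"
    for x x' t u
  proof -
    obtain s where s: "0 < s" "s < 1" "x = (1 - s) *\<^sub>R v + s *\<^sub>R w"
      using x by (auto simp: in_segment)
    obtain s' where s': "0 < s'" "s' < 1" "x' = (1 - s') *\<^sub>R v + s' *\<^sub>R w"
      using x by (auto simp: in_segment)
    have "\<exists>c\<in>K. \<exists>l. 0 < l \<and> l \<le> 1 \<and> x' = (1 - l) *\<^sub>R c + l *\<^sub>R x"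
    proof (cases "s' \<le> s")
      case True
      define l where "l = s' / s"
      have l: "l * s = s'" using s by (simp add: l_def)
      have "(1 - l) *\<^sub>R v + l *\<^sub>R x = (1 - l * s) *\<^sub>R v + (l * s) *\<^sub>R w"
        by (simp add: s algebra_simps)
      also have "\<dots> = x'" by (simp add: l s')
      finally have "x' = (1 - l) *\<^sub>R v + l *\<^sub>R x" by simp
      moreover have "0 < l" "l \<le> 1" using True s s' by (auto simp: l_def)
      ultimately show ?thesis using K by blast
    next
      case False
      define l where "l = (1 - s') / (1 - s)"
      have l: "l * (1 - s) = 1 - s'" using s by (simp add: l_def)
      have "(1 - l) *\<^sub>R w + l *\<^sub>R x = (l * (1 - s)) *\<^sub>R v + (1 - l * (1 - s)) *\<^sub>R w"
        by (simp add: s algebra_simps)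
      also have "\<dots> = x'" by (simp add: l s')
      finally have "x' = (1 - l) *\<^sub>R w + l *\<^sub>R x" by simp
      moreover have "0 < l" "l \<le> 1" using False s s' by (auto simp: l_def)
      ultimately show ?thesis using K by blast
    qed
    then obtain c l where c: "c \<in> K" and l: "0 < l" "l \<le> 1" "x' = (1 - l) *\<^sub>R c + l *\<^sub>R x" by blast
    have "x' + (l * t) *\<^sub>R u = (1 - l) *\<^sub>R c + l *\<^sub>R (x + t *\<^sub>R u)"
      by (simp add: l algebra_simps)
    also have "\<dots> \<in> K" using K(1) c t(2) l by (intro convexD_alt) auto
    finally show ?thesis using t l by (intro exI[of _ "l * t"]) auto
  qed
  show ?thesis
    unfolding chord_angles_def using *[OF x] *[OF x(2) x(1)] by blast
qed

lemma pair_spans_plane: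
  fixes d d' :: "'a::euclidean_space"
  assumes d: "d \<in> span {a, b}" "d' \<in> span {a, b}" and u: "u \<in> span {a, b}"
    and indep: "\<And>\<alpha> \<beta>. \<alpha> *\<^sub>R d + \<beta> *\<^sub>R d' = 0 \<Longrightarrow> \<alpha> = 0 \<and> \<beta> = 0"
  obtains \<alpha> \<beta> where "u = \<alpha> *\<^sub>R d + \<beta> *\<^sub>R d'"
proof -
  have "d \<notin> span {d'}"
  proof
    assume "d \<in> span {d'}"
    then obtain k where "d = k *\<^sub>R d'" by (auto simp: span_singleton)
    then show False using indep[of 1 "- k"] by simp
  qed
  moreover have "d' \<noteq> 0" using indep[of 0 1] by auto
  ultimately have ind: "independent {d, d'}" and ne: "d \<noteq> d'"
    by (auto simp: independent_insert span_base)
  have "dim (span {a, b}) \<le> card {a, b}" by (simp add: dim_le_card')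
  also have "\<dots> \<le> 2" by (simp add: card_insert_if)
  also have "2 = card {d, d'}" using ne by simp
  finally have le: "dim (span {a, b}) \<le> card {d, d'}" .
  have "span {a, b} \<subseteq> span {d, d'}"
    by (rule card_ge_dim_independent[OF _ ind le]) (use d in blast)
  then have "u \<in> span {d, d'}" using u by blast
  then obtain k where "u - k *\<^sub>R d \<in> span {d'}" using span_breakdown_eq by blast
  then obtain l where "u - k *\<^sub>R d = l *\<^sub>R d'" by (auto simp: span_singleton)
  then show ?thesis using that[of k l] by (simp add: algebra_simps)
qed

text \<open>
  Near the edge from \<open>v\<close> to \<open>w\<close>, the convex set \<open>K\<close> is a wedge: it lies in the half-spaces with outer
  normals \<open>n\<close> and \<open>n'\<close>, and its two sides contain \<open>y\<close> and \<open>z\<close>. The half-spaces bound the chords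
  through \<open>x\<close> from outside, the convex hull of \<open>v\<close>, \<open>w\<close>, \<open>y\<close>, \<open>z\<close> from inside, and the bounds agree.
\<close>

lemma hangle_eq_measure_chord_angles:
  fixes K :: "(real ^ 3) set"
  assumes ab: "orthonormal_pair a b" and plane: "\<And>d. d \<bullet> v = 0 \<longleftrightarrow> d \<in> span {a, b}"
    and K: "convex K" "v \<in> K" "w \<in> K" "y \<in> K" "z \<in> K"
    and v: "norm v = 1" and x: "x \<in> hyp3" "x \<in> open_segment v w"
    and n: "\<And>k. k \<in> K \<Longrightarrow> n \<bullet> k \<le> n \<bullet> x" "n \<bullet> v = n \<bullet> x" "n \<bullet> y = n \<bullet> x" "n \<bullet> z < n \<bullet> x"
    and n': "\<And>k. k \<in> K \<Longrightarrow> n' \<bullet> k \<le> n' \<bullet> x" "n' \<bullet> v = n' \<bullet> x" "n' \<bullet> z = n' \<bullet> x" "n' \<bullet> y < n' \<bullet> x"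
    and perp: "hinner x (y - x) (v - x) = 0" "hinner x (z - x) (v - x) = 0"
  shows "chord_angles a b K x \<in> lmeasurable"
    and "hangle x (y - x) (z - x) = measure lebesgue (chord_angles a b K x)"
proof -
  define d d' where "d = horospheric_projection v x (y - x)"
    and "d' = horospheric_projection v x (z - x)"
  have "norm x < 1" using x by (simp add: hyp3_def)
  then have xv: "x \<bullet> v \<noteq> 1" using inner_sphere_less_1[OF v, of x] v by force
  obtain c c' where c: "d = (y - x) + c *\<^sub>R (x - v)" and c': "d' = (z - x) + c' *\<^sub>R (x - v)"
    unfolding d_def d'_def horospheric_projection_def by blast
  have dspan: "d \<in> span {a, b}" "d' \<in> span {a, b}"
    using inner_horospheric_projection_eq_0[OF v xv] by (simp_all add: d_def d'_def flip: plane)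
  have nd: "n \<bullet> d = 0" "n \<bullet> d' < 0" "n' \<bullet> d < 0" "n' \<bullet> d' = 0"
    using n n' by (simp_all add: c c' inner_add_right inner_diff_right)
  have indep: "\<alpha> = 0 \<and> \<beta> = 0" if "\<alpha> *\<^sub>R d + \<beta> *\<^sub>R d' = 0" for \<alpha> \<beta>
  proof -
    have "n \<bullet> (\<alpha> *\<^sub>R d + \<beta> *\<^sub>R d') = 0" "n' \<bullet> (\<alpha> *\<^sub>R d + \<beta> *\<^sub>R d') = 0" using that by simp_all
    then show ?thesis using nd by (simp add: inner_add_right)
  qed
  have chord: "(\<exists>t. t \<noteq> 0 \<and> x + t *\<^sub>R u \<in> K) \<longleftrightarrow> (\<exists>\<alpha> \<beta>. u = \<alpha> *\<^sub>R d + \<beta> *\<^sub>R d' \<and> 0 \<le> \<alpha> * \<beta>)"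
    if u: "u \<in> span {a, b}" for u
  proof
    assume "\<exists>t. t \<noteq> 0 \<and> x + t *\<^sub>R u \<in> K"
    then obtain t where t: "t \<noteq> 0" "x + t *\<^sub>R u \<in> K" by blast
    obtain \<alpha> \<beta> where eq: "u = \<alpha> *\<^sub>R d + \<beta> *\<^sub>R d'"
      by (rule pair_spans_plane[OF dspan u indep])
    have "n \<bullet> (x + t *\<^sub>R u) \<le> n \<bullet> x" "n' \<bullet> (x + t *\<^sub>R u) \<le> n' \<bullet> x"
      using n(1) n'(1) t(2) by blast+
    then have "(t * \<beta>) * (n \<bullet> d') \<le> 0" "(t * \<alpha>) * (n' \<bullet> d) \<le> 0"
      using nd by (simp_all add: eq inner_add_right)
    then have "0 \<le> t * \<beta>" "0 \<le> t * \<alpha>" using nd by (simp_all add: mult_le_0_iff)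
    then have "0 \<le> (t * \<alpha>) * (t * \<beta>)" by simp
    then have "0 \<le> t\<^sup>2 * (\<alpha> * \<beta>)" by (simp add: power2_eq_square ac_simps)
    then have "0 \<le> \<alpha> * \<beta>" using t(1) mult_le_cancel_left_pos[of "t\<^sup>2" 0 "\<alpha> * \<beta>"] by simp
    then show "\<exists>\<alpha> \<beta>. u = \<alpha> *\<^sub>R d + \<beta> *\<^sub>R d' \<and> 0 \<le> \<alpha> * \<beta>" using eq by blast
  next
    assume "\<exists>\<alpha> \<beta>. u = \<alpha> *\<^sub>R d + \<beta> *\<^sub>R d' \<and> 0 \<le> \<alpha> * \<beta>"
    then obtain \<alpha> \<beta> where eq: "u = \<alpha> *\<^sub>R d + \<beta> *\<^sub>R d'" and pos: "0 \<le> \<alpha> * \<beta>" by blast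
    \<comment> \<open>Both coefficients become nonnegative after reversing the line if necessary.\<close>
    obtain s :: real where s: "s \<noteq> 0" "0 \<le> s * \<alpha>" "0 \<le> s * \<beta>"
    proof (cases "0 \<le> \<alpha> \<and> 0 \<le> \<beta>")
      case True
      then show ?thesis using that[of 1] by simp
    next
      case False
      then have "\<alpha> \<le> 0" "\<beta> \<le> 0" using pos by (auto simp: zero_le_mult_iff)
      then show ?thesis using that[of "- 1"] by simp
    qed
    obtain \<rho> where \<rho>: "0 < \<rho>" "\<And>r. \<bar>r\<bar> \<le> \<rho> \<Longrightarrow> x + r *\<^sub>R (x - v) \<in> open_segment v w"
      using open_segment_moves[OF x(2)] by blast
    have seg: "open_segment v w \<subseteq> K"
      using K by (meson convex_contains_open_segment)
    obtain \<epsilon> where \<epsilon>: "0 < \<epsilon>" "x + \<epsilon> *\<^sub>R ((s * \<alpha>) *\<^sub>R (y - x) + (s * \<beta>) *\<^sub>R (z - x) +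
        (s * \<alpha> * c + s * \<beta> * c') *\<^sub>R (x - v)) \<in> K"
      by (rule feasible_direction[OF K(1,4,5) \<rho>(1) _ s(2,3)]) (use \<rho>(2) seg in blast)
    have "(s * \<alpha>) *\<^sub>R (y - x) + (s * \<beta>) *\<^sub>R (z - x) + (s * \<alpha> * c + s * \<beta> * c') *\<^sub>R (x - v) = s *\<^sub>R u"
      by (simp add: eq c c' scaleR_add_right scaleR_add_left mult.assoc)
    then have "x + (\<epsilon> * s) *\<^sub>R u \<in> K" using \<epsilon>(2) by simp
    then show "\<exists>t. t \<noteq> 0 \<and> x + t *\<^sub>R u \<in> K" using \<epsilon>(1) s(1) by (intro exI[of _ "\<epsilon> * s"]) auto
  qed
  have W: "chord_angles a b K x =
      {\<theta>\<in>{0..<pi}. \<exists>\<alpha> \<beta>. direction a b \<theta> = \<alpha> *\<^sub>R d + \<beta> *\<^sub>R d' \<and> 0 \<le> \<alpha> * \<beta>}"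
    unfolding chord_angles_def by (intro Collect_cong conj_cong refl chord direction_in_span)
  show "chord_angles a b K x \<in> lmeasurable"
    unfolding W by (rule measure_double_wedge[OF ab dspan indep])
  have "hangle x (y - x) (z - x) = arccos (d \<bullet> d' / (norm d * norm d'))"
    unfolding d_def d'_def by (rule hangle_perpendicular[OF v x(1) perp])
  also have "\<dots> = measure lebesgue (chord_angles a b K x)"
    unfolding W by (rule measure_double_wedge(2)[OF ab dspan indep, symmetric])
  finally show "hangle x (y - x) (z - x) = measure lebesgue (chord_angles a b K x)" .
qed

section \<open>Faces of an ideal polyhedron\<close>

text \<open>The smallest face containing \<open>x\<close> has \<open>x\<close> on none of its facets.\<close>

lemma in_rel_interior_of_some_face:
  fixes K :: "'a::euclidean_space set"
  assumes K: "polyhedron K" and x: "x \<in> K"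
  obtains F where "F face_of K" "x \<in> rel_interior F"
proof -
  define F where "F = \<Inter>{F. F face_of K \<and> x \<in> F}"
  have "K face_of K" using K by (simp add: face_of_refl polyhedron_imp_convex)
  then have F: "F face_of K"
    unfolding F_def using x by (intro face_of_Inter) auto
  have xF: "x \<in> F" by (auto simp: F_def)
  have "polyhedron F" using K F by (rule face_of_polyhedron_polyhedron)
  have "x \<notin> rel_frontier F"
  proof
    assume "x \<in> rel_frontier F"
    then obtain D where D: "D facet_of F" "x \<in> D"
      using rel_frontier_of_polyhedron[OF \<open>polyhedron F\<close>] by auto
    then have "D face_of K" using F facet_of_imp_face_of face_of_trans by blast
    then have "F \<subseteq> D" using D(2) by (auto simp: F_def)
    then have "D = F" using facet_of_imp_subset[OF D(1)] by blast
    then show False using D(1) by simp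
  qed
  then have "x \<in> rel_interior F"
    using xF closure_subset by (auto simp: rel_frontier_def)
  then show ?thesis using that F by blast
qed

lemma orthonormal_pair_orthogonal_to:
  fixes v :: "real ^ 3"
  assumes "v \<noteq> 0"
  obtains a b where "orthonormal_pair a b" "\<And>d. d \<bullet> v = 0 \<longleftrightarrow> d \<in> span {a, b}"
proof -
  obtain B where B: "B \<subseteq> {x. v \<bullet> x = 0}" "pairwise orthogonal B" "\<And>x. x \<in> B \<Longrightarrow> norm x = 1"
    "independent B" "card B = dim {x. v \<bullet> x = 0}" "span B = {x. v \<bullet> x = 0}"
    using orthonormal_basis_subspace[OF subspace_hyperplane[of v]] by metis
  have "card B = 2" using B(5) dim_hyperplane[OF assms] by simp
  then obtain a b where ab: "B = {a, b}" "a \<noteq> b" by (auto simp: card_2_iff)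
  have "orthonormal_pair a b"
    using B(2,3) ab by (auto simp: orthonormal_pair_def pairwise_def orthogonal_def norm_eq_1)
  moreover have "d \<bullet> v = 0 \<longleftrightarrow> d \<in> span {a, b}" for d
    using B(6) ab by (auto simp: inner_commute)
  ultimately show ?thesis using that by blast
qed

text \<open>
  The polyhedron \<open>P\<close> is not closed, while the theory of faces is available for polytopes. The closure \<open>K\<close>
  is one, with the ideal vertices as its vertices, and intersection with the open ball carries its
  faces of positive dimension to those of \<open>P\<close>.
\<close>

locale ideal_polyhedron =
  fixes P :: "(real ^ 3) set"
  assumes ideal: "convex_ideal_polyhedron P"
begin

abbreviation K :: "(real ^ 3) set"
  where "K \<equiv> closure P"

abbreviation V :: "(real ^ 3) set"
  where "V \<equiv> vertices P"

lemma finite_V: "finite V" and norm_V: "v \<in> V \<Longrightarrow> norm v = 1"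
  and interior_P: "interior P \<noteq> {}"
  using ideal by (auto simp: convex_ideal_polyhedron_def convex_polyhedron_def)

lemma V_iff: "v \<in> V \<longleftrightarrow> v extreme_point_of K"
  by (simp add: vertices_def)

lemma V_subset_K: "V \<subseteq> K"
  by (auto simp: V_iff extreme_point_of_def)

lemma convex_P: "convex P" and P_subset_hyp3: "P \<subseteq> hyp3"
  and P_eq: "P = K \<inter> hyp3"
proof -
  obtain Q where Q: "polyhedron Q" "P = Q \<inter> hyp3"
    using ideal by (auto simp: convex_ideal_polyhedron_def convex_polyhedron_def)
  show "convex P" using Q by (simp add: hyp3_def polyhedron_imp_convex convex_Int)
  show "P \<subseteq> hyp3" using Q by simp
  have "K \<subseteq> Q" using Q by (simp add: closure_minimal polyhedron_imp_closed)
  then show "P = K \<inter> hyp3" using Q closure_subset[of P] by blast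
qed

lemma compact_K: "compact K"
proof -
  have "bounded P" using P_subset_hyp3 bounded_subset[OF bounded_ball] by (auto simp: hyp3_def)
  then show ?thesis by (simp add: compact_closure)
qed

lemma convex_K: "convex K"
  by (rule convex_closure[OF convex_P])

lemma K_eq_hull: "K = convex hull V"
  unfolding vertices_def by (rule Krein_Milman_Minkowski[OF compact_K convex_K])

lemma polytope_K: "polytope K"
  using K_eq_hull finite_V polytope_def by blast

lemma polyhedron_K: "polyhedron K"
  by (rule polytope_imp_polyhedron[OF polytope_K])

lemma aff_dim_P: "aff_dim P = 3" and aff_dim_K: "aff_dim K = 3"
proof -
  show "aff_dim P = 3" using aff_dim_nonempty_interior[OF interior_P] by simp
  then show "aff_dim K = 3" by (simp add: closure_aff_dim)
qed

lemma norm_K: "x \<in> K \<Longrightarrow> norm x \<le> 1"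
proof -
  have "V \<subseteq> cball 0 1" using norm_V by auto
  then have "K \<subseteq> cball 0 1" unfolding K_eq_hull by (simp add: hull_minimal)
  then show "x \<in> K \<Longrightarrow> norm x \<le> 1" by auto
qed

lemma face_Int_hyp3:
  assumes "F face_of K"
  shows "F \<inter> hyp3 face_of P"
  using face_of_slice[OF assms, of hyp3] P_eq by (simp add: hyp3_def)

lemma aff_dim_Int_hyp3:
  assumes "F face_of K" "F \<inter> hyp3 \<noteq> {}"
  shows "aff_dim (F \<inter> hyp3) = aff_dim F"
  using assms by (intro aff_dim_convex_Int_open) (auto simp: face_of_imp_convex hyp3_def)

text \<open>
  The face of \<open>K\<close> is found as the one with a given relatively interior point of \<open>F\<close> in its relative
  interior; since the ball is open, its trace on the ball has that point in its relative interior
  too, and two faces sharing such a point coincide.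
\<close>

lemma face_of_P_extends:
  assumes F: "F face_of P" "F \<noteq> {}"
  obtains F' where "F' face_of K" "F = F' \<inter> hyp3" "aff_dim F' = aff_dim F"
proof -
  obtain x where x: "x \<in> rel_interior F"
    using F face_of_imp_convex rel_interior_eq_empty by blast
  then have "x \<in> F" using rel_interior_subset by blast
  then have xP: "x \<in> P" using face_of_imp_subset[OF F(1)] by blast
  then have "x \<in> K" using closure_subset by blast
  then obtain F' where F': "F' face_of K" "x \<in> rel_interior F'"
    using in_rel_interior_of_some_face[OF polyhedron_K] by blast
  have xh: "x \<in> hyp3" using xP P_subset_hyp3 by blast
  obtain T where T: "open T" "x \<in> T \<inter> F'" "T \<inter> affine hull F' \<subseteq> F'"
    using F'(2) mem_rel_interior by blast
  have "x \<in> rel_interior (F' \<inter> hyp3)"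
    unfolding mem_rel_interior
  proof (intro exI conjI)
    show "open (T \<inter> hyp3)" using T(1) by (simp add: hyp3_def open_Int)
    show "x \<in> (T \<inter> hyp3) \<inter> (F' \<inter> hyp3)" using T(2) xh by simp
    have "affine hull (F' \<inter> hyp3) \<subseteq> affine hull F'" by (intro hull_mono) simp
    then show "(T \<inter> hyp3) \<inter> affine hull (F' \<inter> hyp3) \<subseteq> F' \<inter> hyp3" using T(3) by blast
  qed
  then have eq: "F = F' \<inter> hyp3"
    by (intro face_of_eq[OF F(1) face_Int_hyp3[OF F'(1)]]) (use x in blast)
  then have "aff_dim F' = aff_dim F"
    using aff_dim_Int_hyp3[OF F'(1)] F(2) by simp
  then show ?thesis using that F'(1) eq by blast
qed

text \<open>The sphere is strictly convex, so an edge meets it in its two ends only.\<close>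

lemma edge_of_K_cases:
  assumes e: "e edge_of K"
  obtains v w where "v \<in> V" "w \<in> V" "v \<noteq> w" "e = closed_segment v w" "e \<inter> hyp3 = open_segment v w"
proof -
  have face: "e face_of K" and dim: "aff_dim e = 1" using e by (auto simp: edge_of_def)
  have "e \<noteq> {}" using dim by auto
  moreover have "compact e" by (rule face_of_imp_compact[OF convex_K compact_K face])
  moreover have "convex e" by (rule face_of_imp_convex[OF face])
  moreover have "collinear e" by (simp add: collinear_aff_dim dim)
  ultimately obtain v w where eq: "e = closed_segment v w" using compact_convex_collinear_segment by blast
  have neq: "v \<noteq> w" using dim eq by auto
  have "v extreme_point_of e" "w extreme_point_of e" by (simp_all add: eq extreme_point_of_segment)
  then have V: "v \<in> V" "w \<in> V" using extreme_point_of_face[OF face] by (simp_all add: V_iff)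
  have "x \<in> hyp3" if x: "x \<in> open_segment v w" for x
  proof -
    have "x \<in> e" using x by (auto simp: eq open_segment_def)
    then have "norm x \<le> 1" using face_of_imp_subset[OF face] norm_K by blast
    moreover have "norm x \<noteq> 1"
      using different_norm_3_collinear_points[OF x] norm_V V by metis
    ultimately show ?thesis by (simp add: hyp3_def)
  qed
  moreover have "v \<notin> hyp3" "w \<notin> hyp3" using norm_V V by (auto simp: hyp3_def)
  ultimately have "e \<inter> hyp3 = open_segment v w" by (auto simp: eq open_segment_def)
  then show ?thesis using that V neq eq by blast
qed

lemma edge_of_K_at_vertex:
  assumes e: "e edge_of K" and v: "v \<in> V" "v \<in> e"
  obtains w where "w \<in> V" "v \<noteq> w" "e = closed_segment v w" "e \<inter> hyp3 = open_segment v w"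
proof -
  obtain v' w' where vw: "v' \<in> V" "w' \<in> V" "v' \<noteq> w'" "e = closed_segment v' w'"
      "e \<inter> hyp3 = open_segment v' w'"
    using edge_of_K_cases[OF e] by blast
  have "v extreme_point_of e"
    using e v extreme_point_of_face by (auto simp: edge_of_def V_iff)
  then have "v = v' \<or> v = w'" by (simp add: vw(4) extreme_point_of_segment)
  then show ?thesis
  proof
    assume "v = v'" then show ?thesis using that[of w'] vw by simp
  next
    assume "v = w'" then show ?thesis
      using that[of v'] vw closed_segment_commute open_segment_commute by metis
  qed
qed

lemma card_vertices_of_edge:
  assumes e: "e edge_of K"
  shows "card {v\<in>V. v \<in> e} = 2"
proof -
  obtain v w where vw: "v \<in> V" "w \<in> V" "v \<noteq> w" "e = closed_segment v w"
    using edge_of_K_cases[OF e] by blast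
  have "u \<in> V \<and> u \<in> e \<longleftrightarrow> u extreme_point_of e" for u
    using e extreme_point_of_face[of e K u] by (auto simp: edge_of_def V_iff)
  then have "{v\<in>V. v \<in> e} = {v, w}" by (auto simp: vw(4) extreme_point_of_segment)
  then show ?thesis using vw(3) by simp
qed

lemma rel_interior_edge:
  assumes e: "e edge_of K"
  shows "rel_interior e = e \<inter> hyp3"
  using edge_of_K_cases[OF e] rel_interior_closed_segment by metis

lemma edge_Int_hyp3_nonempty: "e edge_of K \<Longrightarrow> e \<inter> hyp3 \<noteq> {}"
  by (metis edge_of_K_cases open_segment_eq_empty)

lemma bij_betw_edges: "bij_betw (\<lambda>e. e \<inter> hyp3) {e. e edge_of K} {e. e edge_of P}"
proof (rule bij_betw_imageI)
  show "inj_on (\<lambda>e. e \<inter> hyp3) {e. e edge_of K}"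
  proof (rule inj_onI, clarify)
    fix e e' assume e: "e edge_of K" "e' edge_of K" "e \<inter> hyp3 = e' \<inter> hyp3"
    then have "rel_interior e \<inter> rel_interior e' \<noteq> {}"
      using edge_Int_hyp3_nonempty rel_interior_edge by auto
    then show "e = e'" using e(1,2) face_of_eq unfolding edge_of_def by blast
  qed
  show "(\<lambda>e. e \<inter> hyp3) ` {e. e edge_of K} = {e. e edge_of P}"
  proof (intro equalityI subsetI)
    fix e assume "e \<in> (\<lambda>e. e \<inter> hyp3) ` {e. e edge_of K}"
    then obtain e' where e': "e' edge_of K" "e = e' \<inter> hyp3" by blast
    then show "e \<in> {e. e edge_of P}"
      using face_Int_hyp3 aff_dim_Int_hyp3 edge_Int_hyp3_nonempty by (auto simp: edge_of_def)
  next
    fix e assume "e \<in> {e. e edge_of P}"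
    then have e: "e face_of P" "aff_dim e = 1" by (auto simp: edge_of_def)
    then have "e \<noteq> {}" by auto
    then obtain e' where "e' face_of K" "e = e' \<inter> hyp3" "aff_dim e' = aff_dim e"
      using face_of_P_extends[OF e(1)] by blast
    then show "e \<in> (\<lambda>e. e \<inter> hyp3) ` {e. e edge_of K}" using e by (auto simp: edge_of_def)
  qed
qed

lemma finite_edges_K: "finite {e. e edge_of K}"
  by (rule finite_subset[OF _ finite_polytope_faces[OF polytope_K]]) (auto simp: edge_of_def)

section \<open>Dihedral angles\<close>

lemma facet_supporting_normal:
  assumes \<sigma>: "\<sigma> facet_of P" and x: "x \<in> \<sigma>"
  obtains n where "\<And>k. k \<in> K \<Longrightarrow> n \<bullet> k \<le> n \<bullet> x" "\<And>k. k \<in> P \<Longrightarrow> n \<bullet> k = n \<bullet> x \<longleftrightarrow> k \<in> \<sigma>"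
    "\<And>v w. v \<in> K \<Longrightarrow> w \<in> K \<Longrightarrow> x \<in> open_segment v w \<Longrightarrow> n \<bullet> v = n \<bullet> x"
proof -
  obtain F where F: "F face_of K" "\<sigma> = F \<inter> hyp3"
    using face_of_P_extends[of \<sigma>] \<sigma> by (auto simp: facet_of_def)
  then have "F exposed_face_of K" by (simp add: exposed_face_of_polyhedron[OF polyhedron_K])
  then obtain n b where n: "K \<subseteq> {k. n \<bullet> k \<le> b}" "F = K \<inter> {k. n \<bullet> k = b}"
    by (auto simp: exposed_face_of_def)
  have xb: "n \<bullet> x = b" using x F n by auto
  show ?thesis
  proof (rule that)
    show "n \<bullet> k \<le> n \<bullet> x" if "k \<in> K" for k using that n xb by auto
    show "n \<bullet> k = n \<bullet> x \<longleftrightarrow> k \<in> \<sigma>" if "k \<in> P" for k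
      using that P_eq xb by (auto simp: F n)
    show "n \<bullet> v = n \<bullet> x" if "v \<in> K" "w \<in> K" "x \<in> open_segment v w" for v w
      using face_ofD[OF F(1) that(3,1,2)] x F n xb by auto
  qed
qed

lemma facets_meet_in_edge:
  assumes \<sigma>: "\<sigma> facet_of P" and \<tau>: "\<tau> facet_of P" and neq: "\<sigma> \<noteq> \<tau>"
    and e: "e edge_of P" "e \<subseteq> \<sigma>" "e \<subseteq> \<tau>"
  shows "\<sigma> \<inter> \<tau> = e"
proof -
  have s: "\<sigma> face_of P" "aff_dim \<sigma> = 2" and t: "\<tau> face_of P" "aff_dim \<tau> = 2"
    using \<sigma> \<tau> aff_dim_P by (auto simp: facet_of_def)
  have st: "\<sigma> \<inter> \<tau> face_of P" by (rule face_of_Int[OF s(1) t(1)])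
  then have "\<sigma> \<inter> \<tau> face_of \<sigma>" using face_of_imp_subset[OF s(1)] by (auto intro: face_of_subset)
  moreover have "\<sigma> \<inter> \<tau> \<noteq> \<sigma>"
  proof
    assume "\<sigma> \<inter> \<tau> = \<sigma>"
    then have "\<sigma> face_of \<tau>" using s(1) face_of_imp_subset[OF t(1)] by (auto intro: face_of_subset)
    then show False
      using face_of_aff_dim_lt[OF face_of_imp_convex[OF t(1)]] s(2) t(2) neq by force
  qed
  ultimately have "aff_dim (\<sigma> \<inter> \<tau>) < 2"
    using face_of_aff_dim_lt[OF face_of_imp_convex[OF s(1)]] s(2) by force
  moreover have "e face_of \<sigma> \<inter> \<tau>"
    using e face_of_imp_subset[OF st] by (auto simp: edge_of_def intro: face_of_subset)
  ultimately show ?thesis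
    using face_of_aff_dim_lt[OF face_of_imp_convex[OF st]] e(1) by (force simp: edge_of_def)
qed

text \<open>
  A proper face of a polyhedron is the intersection of the facets containing it, and an edge is too
  small to be a single facet.
\<close>

lemma two_facets_at_edge:
  assumes e: "e edge_of K"
  obtains \<sigma> \<tau> where "\<sigma> facet_of P" "\<tau> facet_of P" "\<sigma> \<noteq> \<tau>" "e \<inter> hyp3 \<subseteq> \<sigma>" "e \<inter> hyp3 \<subseteq> \<tau>"
proof -
  have face: "e face_of K" and dim: "aff_dim e = 1" using e by (auto simp: edge_of_def)
  have ne: "e \<noteq> {}" "e \<noteq> K" using dim aff_dim_K by auto
  obtain F where F: "F facet_of K" "e \<subseteq> F"
    by (rule face_of_polyhedron_subset_facet[OF polyhedron_K face ne])
  have dimF: "aff_dim F = 2" using F(1) aff_dim_K by (simp add: facet_of_def)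
  have "\<not> F \<subseteq> e" using F(2) dim dimF by auto
  moreover have "e = \<Inter>{F. F facet_of K \<and> e \<subseteq> F}"
    by (rule face_of_polyhedron[OF polyhedron_K face ne])
  ultimately obtain F' where F': "F' facet_of K" "e \<subseteq> F'" "\<not> F \<subseteq> F'"
    by (metis (no_types, lifting) Inf_greatest mem_Collect_eq)
  have facet: "D \<inter> hyp3 facet_of P" if "D facet_of K" "e \<subseteq> D" for D
  proof -
    have "D face_of K" "aff_dim D = 2" using that(1) aff_dim_K by (auto simp: facet_of_def)
    moreover have "D \<inter> hyp3 \<noteq> {}" using that(2) edge_Int_hyp3_nonempty[OF e] by blast
    ultimately show ?thesis
      using face_Int_hyp3 aff_dim_Int_hyp3 aff_dim_P by (simp add: facet_of_def)
  qed
  have "F \<inter> hyp3 \<noteq> F' \<inter> hyp3"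
  proof
    assume eq: "F \<inter> hyp3 = F' \<inter> hyp3"
    have "aff_dim (F \<inter> hyp3) = 2"
      using aff_dim_Int_hyp3[of F] F edge_Int_hyp3_nonempty[OF e] dimF by (auto simp: facet_of_def)
    then have "2 \<le> aff_dim (F \<inter> F')" using eq aff_dim_subset[of "F \<inter> hyp3" "F \<inter> F'"] by auto
    moreover have "F \<inter> F' face_of F"
      using F F' by (meson Int_lower1 face_of_Int face_of_face facet_of_imp_face_of)
    moreover have "F \<inter> F' \<noteq> F" using F'(3) by blast
    ultimately show False
      using face_of_aff_dim_lt[OF face_of_imp_convex[OF facet_of_imp_face_of[OF F(1)]]] dimF by force
  qed
  then show ?thesis using that facet F F' by blast
qed

lemma perpendicular_to_edge:
  assumes e: "e \<subseteq> hyp3" "e = open_segment v w" and x: "x \<in> e"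
  shows "(\<forall>p\<in>e. hinner x u (p - x) = 0) \<longleftrightarrow> hinner x u (v - x) = 0"
proof -
  obtain s where s: "0 < s" "s < 1" "x = (1 - s) *\<^sub>R v + s *\<^sub>R w" and vw: "v \<noteq> w"
    using x e by (auto simp: in_segment)
  define g where "g = w - v"
  have "v - x = (- s) *\<^sub>R g" by (simp add: s g_def algebra_simps)
  then have vx: "hinner x u (v - x) = 0 \<longleftrightarrow> hinner x u g = 0"
    using s by (simp only: hinner_scaleR_right) simp
  show ?thesis
  proof
    assume all: "\<forall>p\<in>e. hinner x u (p - x) = 0"
    define p where "p = (1 - s / 2) *\<^sub>R v + (s / 2) *\<^sub>R w"
    have "p \<in> e" using s vw unfolding e(2) in_segment p_def by (intro conjI exI[of _ "s / 2"]) auto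
    moreover have "p - x = (- (s / 2)) *\<^sub>R g"
      by (simp add: s p_def g_def algebra_simps flip: scaleR_add_left)
    ultimately have "- (s / 2) * hinner x u g = 0" using all hinner_scaleR_right by metis
    then show "hinner x u (v - x) = 0" using vx s by simp
  next
    assume "hinner x u (v - x) = 0"
    then have g0: "hinner x u g = 0" by (simp add: vx)
    show "\<forall>p\<in>e. hinner x u (p - x) = 0"
    proof
      fix p assume "p \<in> e"
      then obtain r where "p = (1 - r) *\<^sub>R v + r *\<^sub>R w" by (auto simp: e in_segment)
      then have "p - x = (r - s) *\<^sub>R g" by (simp add: s g_def algebra_simps)
      then show "hinner x u (p - x) = 0" using g0 by (simp add: hinner_scaleR_right)
    qed
  qed
qed

text \<open>
  Existence of the segments in the description of the dihedral angle: correct any segment into the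
  facet by a multiple of the direction of the edge, and shorten it to stay in the facet.
\<close>

lemma perpendicular_in_facet:
  assumes \<sigma>: "\<sigma> facet_of P" and e: "e edge_of P" "e \<subseteq> \<sigma>" "e = open_segment v w" and x: "x \<in> e"
  obtains y where "y \<in> \<sigma> - e" "hinner x (y - x) (v - x) = 0"
proof -
  have s: "\<sigma> face_of P" "aff_dim \<sigma> = 2" and ef: "e face_of P" "aff_dim e = 1"
    using \<sigma> e aff_dim_P by (auto simp: facet_of_def edge_of_def)
  have "\<not> \<sigma> \<subseteq> e" using s(2) ef(2) aff_dim_subset[of \<sigma> e] by auto
  then obtain y0 where y0: "y0 \<in> \<sigma>" "y0 \<notin> e" by blast
  have xh: "x \<in> hyp3" using x e(2) face_of_imp_subset[OF s(1)] P_subset_hyp3 by blast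
  have xv: "x \<noteq> v" using x e(3) by (auto simp: open_segment_def)
  obtain \<rho> where \<rho>: "0 < \<rho>" "\<And>r. \<bar>r\<bar> \<le> \<rho> \<Longrightarrow> x + r *\<^sub>R (x - v) \<in> open_segment v w"
    using open_segment_moves[of x v w] x e(3) by blast
  \<comment> \<open>Gram-Schmidt for the form at \<open>x\<close>: subtract from \<open>y0 - x\<close> its component along the edge.\<close>
  define c where "c = hinner x (y0 - x) (v - x) / hinner x (v - x) (v - x)"
  define u where "u = 1 *\<^sub>R (y0 - x) + 0 *\<^sub>R (y0 - x) + c *\<^sub>R (x - v)"
  have u: "u = (y0 - x) + (- c) *\<^sub>R (v - x)" by (simp add: u_def algebra_simps)
  have "hinner x (v - x) (v - x) > 0" using hinner_pos[OF xh, of "v - x"] xv by simp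
  then have perp: "hinner x u (v - x) = 0"
    unfolding u hinner_add_left hinner_scaleR_left by (simp add: c_def)
  obtain \<epsilon> where \<epsilon>: "0 < \<epsilon>" "x + \<epsilon> *\<^sub>R u \<in> \<sigma>"
    unfolding u_def
    by (rule feasible_direction[OF face_of_imp_convex[OF s(1)] y0(1) y0(1) \<rho>(1), of x "x - v" 1 0 c])
      (use \<rho>(2) e in auto)
  have "x + \<epsilon> *\<^sub>R u \<notin> e"
  proof
    assume in_e: "x + \<epsilon> *\<^sub>R u \<in> e"
    let ?A = "affine hull e"
    have A: "affine ?A" by (rule affine_affine_hull)
    have xA: "x \<in> ?A" and uA: "x + \<epsilon> *\<^sub>R u \<in> ?A" using x in_e by (simp_all add: hull_inc)
    have "x + \<rho> *\<^sub>R (x - v) \<in> ?A" using \<rho> e(3) by (intro hull_inc) auto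
    then have "x + (- c / \<rho>) *\<^sub>R ((x + \<rho> *\<^sub>R (x - v)) - x) \<in> ?A"
      by (rule mem_affine_3_minus[OF A xA _ xA])
    then have "x + (- c) *\<^sub>R (x - v) \<in> ?A" using \<rho>(1) by simp
    then have "(x + (- c) *\<^sub>R (x - v)) + (1 / \<epsilon>) *\<^sub>R ((x + \<epsilon> *\<^sub>R u) - x) \<in> ?A"
      by (rule mem_affine_3_minus[OF A _ uA xA])
    also have "(x + (- c) *\<^sub>R (x - v)) + (1 / \<epsilon>) *\<^sub>R ((x + \<epsilon> *\<^sub>R u) - x) = x + (- c) *\<^sub>R (x - v) + u"
      using \<epsilon>(1) by simp
    also have "\<dots> = y0" by (simp add: u_def)
    finally have "y0 \<in> ?A \<inter> P" using y0(1) face_of_imp_subset[OF s(1)] by blast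
    then show False using face_of_imp_eq_affine_Int[OF convex_P ef(1)] y0(2) by blast
  qed
  then have "x + \<epsilon> *\<^sub>R u \<in> \<sigma> - e" using \<epsilon>(2) by blast
  moreover have "hinner x ((x + \<epsilon> *\<^sub>R u) - x) (v - x) = 0"
    using perp by (simp add: hinner_scaleR_left)
  ultimately show ?thesis by (rule that)
qed

text \<open>
  Any admissible choice of faces, point and perpendicular segments gives the measure of the set of
  chords. This set does not depend on the faces or segments, and it is the same at all points of the
  edge; so the description of the dihedral angle is unique.
\<close>

lemma dihedral_angle_eq_measure:
  assumes e: "e edge_of K" and v: "v \<in> V" "v \<in> e" and x: "x \<in> e \<inter> hyp3"
    and ab: "orthonormal_pair a b" and plane: "\<And>d. d \<bullet> v = 0 \<longleftrightarrow> d \<in> span {a, b}"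
  shows "chord_angles a b K x \<in> lmeasurable"
    and "dihedral_angle P (e \<inter> hyp3) = measure lebesgue (chord_angles a b K x)"
proof -
  obtain w where w: "w \<in> V" "v \<noteq> w" "e = closed_segment v w" "e \<inter> hyp3 = open_segment v w"
    by (rule edge_of_K_at_vertex[OF e v])
  have eP: "e \<inter> hyp3 edge_of P" using bij_betw_edges e by (auto simp: bij_betw_def)
  have VK: "v \<in> K" "w \<in> K" using v w V_subset_K by auto
  have main: "chord_angles a b K x' \<in> lmeasurable \<and>
      hangle x' (y - x') (z - x') = measure lebesgue (chord_angles a b K x')"
    if \<sigma>: "\<sigma> facet_of P" and \<tau>: "\<tau> facet_of P" and neq: "\<sigma> \<noteq> \<tau>"
      and sub: "e \<inter> hyp3 \<subseteq> \<sigma>" "e \<inter> hyp3 \<subseteq> \<tau>"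
      and x': "x' \<in> e \<inter> hyp3" and y: "y \<in> \<sigma> - (e \<inter> hyp3)" and z: "z \<in> \<tau> - (e \<inter> hyp3)"
      and perp: "hinner x' (y - x') (v - x') = 0" "hinner x' (z - x') (v - x') = 0"
    for \<sigma> \<tau> x' y z
  proof -
    have meet: "\<sigma> \<inter> \<tau> = e \<inter> hyp3" by (rule facets_meet_in_edge[OF \<sigma> \<tau> neq eP sub])
    have P: "y \<in> P" "z \<in> P" using y z \<sigma> \<tau> facet_of_imp_subset by blast+
    then have PK: "y \<in> K" "z \<in> K" using closure_subset by blast+
    have xs: "x' \<in> \<sigma>" "x' \<in> \<tau>" using x' sub by auto
    have xseg: "x' \<in> open_segment v w" using x' w(4) by simp
    obtain n where n: "\<And>k. k \<in> K \<Longrightarrow> n \<bullet> k \<le> n \<bullet> x'" "\<And>k. k \<in> P \<Longrightarrow> n \<bullet> k = n \<bullet> x' \<longleftrightarrow> k \<in> \<sigma>"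
      "\<And>v w. v \<in> K \<Longrightarrow> w \<in> K \<Longrightarrow> x' \<in> open_segment v w \<Longrightarrow> n \<bullet> v = n \<bullet> x'"
      using facet_supporting_normal[OF \<sigma> xs(1)] by blast
    obtain n' where n': "\<And>k. k \<in> K \<Longrightarrow> n' \<bullet> k \<le> n' \<bullet> x'" "\<And>k. k \<in> P \<Longrightarrow> n' \<bullet> k = n' \<bullet> x' \<longleftrightarrow> k \<in> \<tau>"
      "\<And>v w. v \<in> K \<Longrightarrow> w \<in> K \<Longrightarrow> x' \<in> open_segment v w \<Longrightarrow> n' \<bullet> v = n' \<bullet> x'"
      using facet_supporting_normal[OF \<tau> xs(2)] by blast
    have "n \<bullet> y = n \<bullet> x'" "n' \<bullet> z = n' \<bullet> x'" using n(2) n'(2) P y z by blast+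
    moreover have "n \<bullet> z \<noteq> n \<bullet> x'" "n' \<bullet> y \<noteq> n' \<bullet> x'" using n(2) n'(2) P y z meet by blast+
    moreover have "n \<bullet> z \<le> n \<bullet> x'" "n' \<bullet> y \<le> n' \<bullet> x'" using n(1) n'(1) PK by blast+
    moreover have "n \<bullet> v = n \<bullet> x'" "n' \<bullet> v = n' \<bullet> x'" using n(3) n'(3) VK xseg by blast+
    moreover have "x' \<in> hyp3" using x' by blast
    ultimately show ?thesis
      using hangle_eq_measure_chord_angles[of a b v K w y z x' n n'] ab plane convex_K VK PK
        norm_V[OF v(1)] xseg n(1) n'(1) perp
      by (auto simp: less_le)
  qed
  have const: "chord_angles a b K x' = chord_angles a b K x" if "x' \<in> e \<inter> hyp3" for x'
    using that x w(4) by (intro chord_angles_constant_on_segment[OF convex_K VK]) auto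
  have perp_iff: "(\<forall>p\<in>e \<inter> hyp3. hinner x' u (p - x') = 0) \<longleftrightarrow> hinner x' u (v - x') = 0"
    if "x' \<in> e \<inter> hyp3" for x' u
    using that by (intro perpendicular_to_edge[OF _ w(4)]) auto
  obtain \<sigma> \<tau> where st: "\<sigma> facet_of P" "\<tau> facet_of P" "\<sigma> \<noteq> \<tau>" "e \<inter> hyp3 \<subseteq> \<sigma>" "e \<inter> hyp3 \<subseteq> \<tau>"
    by (rule two_facets_at_edge[OF e])
  obtain y where y: "y \<in> \<sigma> - (e \<inter> hyp3)" "hinner x (y - x) (v - x) = 0"
    by (rule perpendicular_in_facet[OF st(1) eP st(4) w(4) x])
  obtain z where z: "z \<in> \<tau> - (e \<inter> hyp3)" "hinner x (z - x) (v - x) = 0"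
    by (rule perpendicular_in_facet[OF st(2) eP st(5) w(4) x])
  note mainx = main[OF st x y(1) z(1) y(2) z(2)]
  show "chord_angles a b K x \<in> lmeasurable" using mainx by blast
  show "dihedral_angle P (e \<inter> hyp3) = measure lebesgue (chord_angles a b K x)"
    unfolding dihedral_angle_def
  proof (rule the_equality)
    show "\<exists>\<sigma> \<tau> x' y z. \<sigma> facet_of P \<and> \<tau> facet_of P \<and> \<sigma> \<noteq> \<tau> \<and> e \<inter> hyp3 \<subseteq> \<sigma> \<and> e \<inter> hyp3 \<subseteq> \<tau> \<and>
        x' \<in> e \<inter> hyp3 \<and> y \<in> \<sigma> - e \<inter> hyp3 \<and> z \<in> \<tau> - e \<inter> hyp3 \<and>
        (\<forall>p\<in>e \<inter> hyp3. hinner x' (y - x') (p - x') = 0 \<and> hinner x' (z - x') (p - x') = 0) \<and>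
        measure lebesgue (chord_angles a b K x) = hangle x' (y - x') (z - x')"
    proof (intro exI conjI ballI)
      fix p assume p: "p \<in> e \<inter> hyp3"
      show "hinner x (y - x) (p - x) = 0" "hinner x (z - x) (p - x) = 0"
        using perp_iff[OF x] y(2) z(2) p by blast+
    qed (use st x y(1) z(1) mainx[THEN conjunct2, symmetric] in blast)+
  next
    fix \<theta>
    assume "\<exists>\<sigma> \<tau> x' y z. \<sigma> facet_of P \<and> \<tau> facet_of P \<and> \<sigma> \<noteq> \<tau> \<and> e \<inter> hyp3 \<subseteq> \<sigma> \<and> e \<inter> hyp3 \<subseteq> \<tau> \<and>
        x' \<in> e \<inter> hyp3 \<and> y \<in> \<sigma> - e \<inter> hyp3 \<and> z \<in> \<tau> - e \<inter> hyp3 \<and>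
        (\<forall>p\<in>e \<inter> hyp3. hinner x' (y - x') (p - x') = 0 \<and> hinner x' (z - x') (p - x') = 0) \<and>
        \<theta> = hangle x' (y - x') (z - x')"
    then obtain \<sigma> \<tau> x' y z where *: "\<sigma> facet_of P" "\<tau> facet_of P" "\<sigma> \<noteq> \<tau>" "e \<inter> hyp3 \<subseteq> \<sigma>" "e \<inter> hyp3 \<subseteq> \<tau>"
        "x' \<in> e \<inter> hyp3" "y \<in> \<sigma> - e \<inter> hyp3" "z \<in> \<tau> - e \<inter> hyp3"
        and perp: "\<forall>p\<in>e \<inter> hyp3. hinner x' (y - x') (p - x') = 0 \<and> hinner x' (z - x') (p - x') = 0"
        and \<theta>: "\<theta> = hangle x' (y - x') (z - x')"
      by blast
    have "hinner x' (y - x') (v - x') = 0" "hinner x' (z - x') (v - x') = 0"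
      using perp perp_iff[OF *(6)] by blast+
    then show "\<theta> = measure lebesgue (chord_angles a b K x)"
      using main[OF *] const[OF *(6)] \<theta> by simp
  qed
qed

section \<open>The sum of the dihedral angles\<close>

text \<open>
  Consider the face with \<open>q\<close> in its relative interior. If it had dimension two or more, then it would
  meet the hyperplane in a segment around \<open>q\<close>, and \<open>q\<close> would not be extreme in the section.
\<close>

lemma vertex_of_section:
  fixes K :: "'a::euclidean_space set"
  assumes K: "polyhedron K" and q: "q extreme_point_of (K \<inter> {x. m \<bullet> x = c})"
    and nv: "\<not> q extreme_point_of K"
  obtains e where "e edge_of K" "q \<in> rel_interior e"
proof -
  have qK: "q \<in> K" "m \<bullet> q = c" using q by (auto simp: extreme_point_of_def)
  obtain F where F: "F face_of K" "q \<in> rel_interior F"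
    using in_rel_interior_of_some_face[OF K qK(1)] by blast
  have qF: "q \<in> F" using F(2) rel_interior_subset by blast
  define A where "A = affine hull F"
  have "aff_dim F \<noteq> -1" using qF aff_dim_empty by blast
  moreover have "aff_dim F \<noteq> 0"
  proof
    assume "aff_dim F = 0"
    then obtain a where "F = {a}" using aff_dim_eq_0 by blast
    then have "F = {q}" using qF by simp
    then show False using F(1) nv by (simp add: face_of_singleton)
  qed
  moreover have "aff_dim F < 2"
  proof (rule ccontr)
    assume "\<not> aff_dim F < 2"
    then have "aff_dim A \<ge> 2" by (simp add: A_def)
    moreover have "q \<in> A \<inter> {x. m \<bullet> x = c}" using qF qK by (simp add: A_def hull_inc)
    moreover have "affine A" by (simp add: A_def)
    ultimately have dim: "aff_dim (A \<inter> {x. m \<bullet> x = c}) \<ge> 1"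
      by (subst aff_dim_affine_Int_hyperplane) auto
    have "\<not> A \<inter> {x. m \<bullet> x = c} \<subseteq> {q}"
    proof
      assume "A \<inter> {x. m \<bullet> x = c} \<subseteq> {q}"
      from aff_dim_subset[OF this] show False using dim by simp
    qed
    then obtain q' where q': "q' \<in> A" "m \<bullet> q' = c" "q' \<noteq> q" by blast
    obtain \<epsilon> where \<epsilon>: "0 < \<epsilon>" "cball q \<epsilon> \<inter> A \<subseteq> F"
      using F(2) by (auto simp: mem_rel_interior_cball A_def)
    define \<delta> where "\<delta> = \<epsilon> / norm (q' - q)"
    have \<delta>: "\<delta> \<noteq> 0" "\<bar>\<delta>\<bar> * norm (q' - q) = \<epsilon>" using \<epsilon>(1) q'(3) by (auto simp: \<delta>_def)
    have in_section: "q + r *\<^sub>R (q' - q) \<in> K \<inter> {x. m \<bullet> x = c}" if "\<bar>r\<bar> = \<bar>\<delta>\<bar>" for r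
    proof -
      have "q + r *\<^sub>R (q' - q) \<in> A"
        by (rule mem_affine_3_minus[OF \<open>affine A\<close> _ q'(1)]) (use qF in \<open>auto simp: A_def hull_inc\<close>)
      moreover have "q + r *\<^sub>R (q' - q) \<in> cball q \<epsilon>"
        using \<delta>(2) that by (simp add: dist_norm)
      ultimately have "q + r *\<^sub>R (q' - q) \<in> F" using \<epsilon>(2) by blast
      then show ?thesis
        using face_of_imp_subset[OF F(1)] q' qK by (auto simp: inner_add_right inner_diff_right)
    qed
    let ?p = "q + \<delta> *\<^sub>R (q' - q)" and ?p' = "q + (- \<delta>) *\<^sub>R (q' - q)"
    have mid: "midpoint ?p ?p' = q" by (simp add: midpoint_def algebra_simps flip: scaleR_2)
    have "?p - ?p' = \<delta> *\<^sub>R (q' - q) + \<delta> *\<^sub>R (q' - q)" by simp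
    then have "?p - ?p' = (\<delta> + \<delta>) *\<^sub>R (q' - q)" by (simp only: scaleR_left_distrib)
    moreover have "(\<delta> + \<delta>) *\<^sub>R (q' - q) \<noteq> 0" using \<delta>(1) q'(3) by simp
    ultimately have "?p \<noteq> ?p'" by (metis right_minus_eq)
    then have "q \<in> open_segment ?p ?p'" using mid midpoint_in_open_segment by metis
    then show False
      using q in_section[of \<delta>] in_section[of "- \<delta>"] unfolding extreme_point_of_def by auto
  qed
  moreover have "aff_dim F \<ge> -1" by (rule aff_dim_geq)
  ultimately have "aff_dim F = 1" by linarith
  then show ?thesis using that F by (simp add: edge_of_def)
qed

text \<open>
  A plane orthogonal to \<open>v\<close> that cuts off \<open>v\<close> alone meets the polyhedron in a polygon with one vertex on
  each edge through \<open>v\<close>. Chords at these vertices are the same for the polygon and for \<open>K\<close>, so the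
  angle sum of the polygon is the sum of the dihedral angles.
\<close>

lemma sum_dihedral_angles_at_vertex:
  assumes v: "v \<in> V"
  defines "E \<equiv> {e. e edge_of K \<and> v \<in> e}"
  shows "(\<Sum>e\<in>E. dihedral_angle P (e \<inter> hyp3)) = pi * (real (card E) - 2)"
proof -
  have nv: "norm v = 1" by (rule norm_V[OF v])
  have vv: "v \<bullet> v = 1" using nv by (simp add: norm_eq_sqrt_inner)
  have "v \<noteq> 0" using nv by auto
  then obtain a b where ab: "orthonormal_pair a b" and plane: "\<And>d. d \<bullet> v = 0 \<longleftrightarrow> d \<in> span {a, b}"
    using orthonormal_pair_orthogonal_to by blast
  have finE: "finite E" unfolding E_def using finite_edges_K by (rule rev_finite_subset) auto
  obtain c where c: "c < 1" "\<And>w. w \<in> V \<Longrightarrow> w \<noteq> v \<Longrightarrow> v \<bullet> w < c"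
  proof -
    define M where "M = Max (insert 0 ((\<lambda>w. v \<bullet> w) ` (V - {v})))"
    have fin: "finite (insert 0 ((\<lambda>w. v \<bullet> w) ` (V - {v})))" using finite_V by simp
    have "\<forall>m \<in> insert 0 ((\<lambda>w. v \<bullet> w) ` (V - {v})). m < 1"
      using inner_sphere_less_1[OF nv] norm_V by (auto simp: inner_commute)
    then have "M < 1" unfolding M_def using fin Max_in by blast
    moreover have "v \<bullet> w \<le> M" if "w \<in> V" "w \<noteq> v" for w
      unfolding M_def using fin that by (intro Max_ge) auto
    ultimately show ?thesis using that[of "(M + 1) / 2"] by force
  qed
  define H where "H = {x. v \<bullet> x = c}"
  define C where "C = K \<inter> H"
  define X where "X = {p. p extreme_point_of C}"
  have C: "compact C" "convex C"
    unfolding C_def H_def using compact_K convex_K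
    by (auto intro: compact_Int_closed closed_hyperplane convex_Int convex_hyperplane)
  have planeC: "x - y \<in> span {a, b}" if "x \<in> C" "y \<in> C" for x y
    using that by (simp add: C_def H_def inner_commute[of _ v] inner_diff_right flip: plane)
  \<comment> \<open>The plane separates \<open>v\<close> from the other vertices, so it cuts each segment from \<open>v\<close> once.\<close>
  have cut: "\<exists>s q. 0 < s \<and> s < 1 \<and> q = v + s *\<^sub>R (w - v) \<and> q \<in> open_segment v w \<and> closed_segment v w \<inter> H = {q}"
    if w: "w \<in> V" "w \<noteq> v" for w
  proof -
    have vw: "v \<bullet> w < c" by (rule c(2)[OF w])
    define s where "s = (1 - c) / (1 - v \<bullet> w)"
    have s: "0 < s" "s < 1" using vw c(1) by (auto simp: s_def)
    define q where "q = v + s *\<^sub>R (w - v)"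
    have q: "q = (1 - s) *\<^sub>R v + s *\<^sub>R w" by (simp add: q_def algebra_simps)
    have q_seg: "q \<in> open_segment v w" using s w(2) by (auto simp: in_segment q)
    have unique: "r = s" if "(1 - r) *\<^sub>R v + r *\<^sub>R w \<in> H" for r
    proof -
      have "r * (1 - v \<bullet> w) = 1 - c"
        using that vv by (simp add: H_def inner_add_right algebra_simps)
      then show ?thesis using vw c(1) by (simp add: s_def eq_divide_eq)
    qed
    have "s * (1 - v \<bullet> w) = 1 - c" using vw c(1) by (simp add: s_def)
    then have "q \<in> H" using vv by (simp add: H_def q inner_add_right algebra_simps)
    moreover have "q \<in> closed_segment v w" using q_seg by (simp add: open_segment_def)
    moreover have "x = q" if "x \<in> closed_segment v w" "x \<in> H" for x
    proof -
      obtain r where r: "x = (1 - r) *\<^sub>R v + r *\<^sub>R w" using \<open>x \<in> closed_segment v w\<close> in_segment(1) by blast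
      then have "r = s" using that(2) unique by blast
      then show ?thesis using r q by simp
    qed
    ultimately have "closed_segment v w \<inter> H = {q}" by blast
    then show ?thesis using s q_def q_seg by blast
  qed
  have "\<exists>q. e \<inter> H = {q} \<and> q \<in> e \<inter> hyp3" if "e \<in> E" for e
  proof -
    have e: "e edge_of K" "v \<in> e" using that by (auto simp: E_def)
    obtain w where w: "w \<in> V" "v \<noteq> w" "e = closed_segment v w" "e \<inter> hyp3 = open_segment v w"
      by (rule edge_of_K_at_vertex[OF e(1) v e(2)])
    then show ?thesis using cut[OF w(1)] by metis
  qed
  then obtain f where f: "\<And>e. e \<in> E \<Longrightarrow> e \<inter> H = {f e} \<and> f e \<in> e \<inter> hyp3" by metis
  have bij: "bij_betw f E X"
  proof (rule bij_betw_imageI)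
    show "inj_on f E"
    proof (rule inj_onI)
      fix e e' assume e: "e \<in> E" "e' \<in> E" "f e = f e'"
      then have "f e \<in> rel_interior e \<inter> rel_interior e'"
        using f[OF e(1)] f[OF e(2)] rel_interior_edge by (auto simp: E_def)
      then show "e = e'" using e(1,2) face_of_eq unfolding E_def edge_of_def by blast
    qed
    show "f ` E = X"
    proof (intro equalityI subsetI)
      fix q assume "q \<in> f ` E"
      then obtain e where e: "e \<in> E" "q = f e" by blast
      then have "e \<inter> H face_of K \<inter> H"
        by (intro face_of_slice) (auto simp: E_def edge_of_def H_def convex_hyperplane)
      then show "q \<in> X" using f[OF e(1)] e(2) by (simp add: X_def C_def face_of_singleton)
    next
      fix q assume "q \<in> X"
      then have q: "q extreme_point_of (K \<inter> {x. v \<bullet> x = c})" by (simp add: X_def C_def H_def)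
      then have qH: "v \<bullet> q = c" by (simp add: extreme_point_of_def)
      have "q \<notin> V" using qH c vv by (cases "q = v") force+
      then obtain e where e: "e edge_of K" "q \<in> rel_interior e"
        using vertex_of_section[OF polyhedron_K q] by (auto simp: V_iff)
      obtain u w where uw: "u \<in> V" "w \<in> V" "u \<noteq> w" "e = closed_segment u w"
        using edge_of_K_cases[OF e(1)] by blast
      have qe: "q \<in> e" using e(2) rel_interior_subset by blast
      have "v \<in> e"
      proof (rule ccontr)
        assume "v \<notin> e"
        then have "u \<noteq> v" "w \<noteq> v" using uw(4) by auto
        then have "closed_segment u w \<subseteq> {x. v \<bullet> x < c}"
          using c(2) uw by (intro closed_segment_subset convex_halfspace_lt) auto
        then show False using qe qH uw(4) by auto
      qed
      then have "e \<in> E" using e(1) by (simp add: E_def)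
      moreover from this have "q = f e" using f[of e] qe qH by (auto simp: H_def)
      ultimately show "q \<in> f ` E" by blast
    qed
  qed
  then have finX: "finite X" using finE bij_betw_finite by blast
  \<comment> \<open>With a single vertex, the section would be a point and all of \<open>K\<close> would lie on one line.\<close>
  have "2 \<le> card X"
  proof (rule ccontr)
    assume "\<not> 2 \<le> card X"
    then have "card X \<le> Suc 0" by simp
    then obtain q where q: "X \<subseteq> {q}" using finX by (metis card_le_Suc0_iff_eq insertI1 subsetI)
    have "C = convex hull X" unfolding X_def by (rule Krein_Milman_Minkowski[OF C])
    then have Cq: "C \<subseteq> {q}" using hull_mono[OF q, of convex] by simp
    have "V \<subseteq> affine hull {v, q}"
    proof
      fix w assume w: "w \<in> V"
      show "w \<in> affine hull {v, q}"
      proof (cases "w = v")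
        case True then show ?thesis by (simp add: hull_inc)
      next
        case False
        then obtain s p where s: "0 < s" "p = v + s *\<^sub>R (w - v)" "p \<in> open_segment v w"
            "closed_segment v w \<inter> H = {p}"
          using cut[OF w] by blast
        have "closed_segment v w \<subseteq> K"
          using v w V_subset_K by (intro closed_segment_subset convex_K) auto
        then have "p \<in> C" using s(4) by (auto simp: C_def)
        then have "p = q" using Cq by blast
        have "v + (1 / s) *\<^sub>R (q - v) \<in> affine hull {v, q}"
          by (rule mem_affine_3_minus) (auto simp: hull_inc)
        also have "v + (1 / s) *\<^sub>R (q - v) = w"
          using s(1) by (simp add: s(2) flip: \<open>p = q\<close>)
        finally show ?thesis .
      qed
    qed
    then have "convex hull V \<subseteq> affine hull {v, q}"
      by (rule hull_minimal) (rule affine_imp_convex[OF affine_affine_hull])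
    then have "aff_dim K \<le> aff_dim (affine hull {v, q})"
      unfolding K_eq_hull by (rule aff_dim_subset)
    also have "\<dots> \<le> 1" by (simp only: aff_dim_affine_hull aff_dim_2 split: if_splits) simp
    finally show False using aff_dim_K by simp
  qed
  have chords: "chord_angles a b C p = chord_angles a b K p" if "p \<in> X" for p
  proof -
    have pH: "v \<bullet> p = c" using that by (auto simp: X_def extreme_point_of_def C_def H_def)
    have "v \<bullet> direction a b \<theta> = 0" for \<theta>
      using plane direction_in_span by (metis inner_commute)
    then have "p + t *\<^sub>R direction a b \<theta> \<in> H" for t \<theta>
      using pH by (simp add: H_def inner_add_right)
    then show ?thesis by (simp add: chord_angles_def C_def)
  qed
  have dihedral: "chord_angles a b K (f e) \<in> lmeasurable"
    "dihedral_angle P (e \<inter> hyp3) = measure lebesgue (chord_angles a b K (f e))" if "e \<in> E" for e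
    using dihedral_angle_eq_measure[OF _ v _ _ ab plane, of e "f e"] that f[OF that]
    by (auto simp: E_def)
  have "(\<Sum>e\<in>E. dihedral_angle P (e \<inter> hyp3)) = (\<Sum>e\<in>E. measure lebesgue (chord_angles a b K (f e)))"
    by (intro sum.cong refl dihedral)
  also have "\<dots> = (\<Sum>p\<in>X. measure lebesgue (chord_angles a b K p))"
    by (rule sum.reindex_bij_betw[OF bij])
  also have "\<dots> = (\<Sum>p\<in>X. measure lebesgue (chord_angles a b C p))"
    by (intro sum.cong refl) (simp add: chords)
  also have "\<dots> = pi * (real (card X) - 2)"
  proof (rule sum_chord_angles[OF ab C planeC X_def finX \<open>2 \<le> card X\<close>])
    fix p assume p: "p \<in> X"
    then obtain e where "e \<in> E" "p = f e" using bij by (auto simp: bij_betw_def)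
    then show "chord_angles a b C p \<in> lmeasurable" using dihedral(1) chords[OF p] by simp
  qed
  also have "card X = card E" using bij_betw_same_card[OF bij] by simp
  finally show ?thesis .
qed

text \<open>Every edge has two ends, so the sum over the vertices counts each edge twice.\<close>

lemma sum_dihedral_angles:
  "(\<Sum>e | e edge_of P. dihedral_angle P e) = pi * (real (card {e. e edge_of P}) - real (card V))"
proof -
  define E where "E = {e. e edge_of K}"
  have twice: "(\<Sum>v\<in>V. \<Sum>e | e \<in> E \<and> v \<in> e. h e) = 2 * (\<Sum>e\<in>E. h e)" for h :: "_ \<Rightarrow> real"
  proof -
    have "(\<Sum>v\<in>V. \<Sum>e | e \<in> E \<and> v \<in> e. h e) = (\<Sum>e\<in>E. \<Sum>v | v \<in> V \<and> v \<in> e. h e)"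
      by (rule sum.swap_restrict) (auto simp: E_def finite_V finite_edges_K)
    also have "\<dots> = (\<Sum>e\<in>E. 2 * h e)"
      by (intro sum.cong refl) (simp add: card_vertices_of_edge E_def)
    finally show ?thesis by (simp add: sum_distrib_left)
  qed
  have "2 * (\<Sum>e\<in>E. dihedral_angle P (e \<inter> hyp3)) =
      (\<Sum>v\<in>V. pi * (real (card {e. e \<in> E \<and> v \<in> e}) - 2))"
    unfolding twice[symmetric]
    by (intro sum.cong refl) (simp add: E_def sum_dihedral_angles_at_vertex)
  also have "\<dots> = pi * ((\<Sum>v\<in>V. \<Sum>e | e \<in> E \<and> v \<in> e. 1) - 2 * real (card V))"
    by (simp add: sum_distrib_left[symmetric] sum_subtractf)
  also have "\<dots> = 2 * (pi * (real (card E) - real (card V)))"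
    unfolding twice by (simp add: algebra_simps)
  finally have "(\<Sum>e\<in>E. dihedral_angle P (e \<inter> hyp3)) = pi * (real (card E) - real (card V))" by simp
  moreover have "(\<Sum>e\<in>E. dihedral_angle P (e \<inter> hyp3)) = (\<Sum>e | e edge_of P. dihedral_angle P e)"
    unfolding E_def by (rule sum.reindex_bij_betw[OF bij_betw_edges])
  moreover have "card E = card {e. e edge_of P}"
    unfolding E_def by (rule bij_betw_same_card[OF bij_betw_edges])
  ultimately show ?thesis by simp
qed

lemma finite_edges: "finite {e. e edge_of P}"
  using bij_betw_finite[OF bij_betw_edges] finite_edges_K by blast

end

section \<open>Edge classes\<close>

lemma sum_over_edge_classes:
  fixes h :: "(real ^ 3) set \<Rightarrow> real"
  assumes fin: "finite {e. e edge_of P}"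
  shows "(\<Sum>C\<in>edge_classes P \<gamma>. \<Sum>e\<in>C. h e) = (\<Sum>e | e edge_of P. h e)"
proof -
  define A where "A = {e. e edge_of P}"
  define R where "R = (edge_pairing P \<gamma> \<union> (edge_pairing P \<gamma>)\<inverse>)\<^sup>* \<inter> A \<times> A"
  have sym: "sym ((edge_pairing P \<gamma> \<union> (edge_pairing P \<gamma>)\<inverse>)\<^sup>*)"
    by (intro sym_rtrancl sym_Un_converse)
  have eq: "equiv A R"
  proof (rule equivI)
    show "R \<subseteq> A \<times> A" by (auto simp: R_def)
    show "refl_on A R" by (auto simp: refl_on_def R_def)
    show "sym R" using sym by (auto simp: R_def sym_def)
    show "trans R" unfolding R_def by (rule transI) (auto intro: rtrancl_trans)
  qed
  have classes: "edge_classes P \<gamma> = A // R" by (simp add: edge_classes_def A_def R_def)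
  have "\<forall>C\<in>A // R. finite C"
    using in_quotient_imp_subset[OF eq] fin finite_subset unfolding A_def by blast
  moreover have "\<forall>C\<in>A // R. \<forall>D\<in>A // R. C \<noteq> D \<longrightarrow> C \<inter> D = {}"
    using quotient_disj[OF eq] by blast
  ultimately have "sum h (\<Union>(A // R)) = (\<Sum>C\<in>A // R. \<Sum>e\<in>C. h e)"
    using sum.Union_disjoint[of "A // R" h] by (simp add: comp_def)
  then show ?thesis using Union_quotient[OF eq] by (simp add: classes A_def)
qed

theorem proposition4p1:
  fixes G :: "(real ^ 3 \<Rightarrow> real ^ 3) set"
    and P :: "(real ^ 3) set"
    and \<gamma> :: "(real ^ 3) set \<Rightarrow> real ^ 3 \<Rightarrow> real ^ 3"
  assumes "kleinian_group G"
    and "convex_ideal_polyhedron P"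
    and "fundamental_polyhedron G P \<gamma>"
    and "\<And>\<sigma>. \<sigma> facet_of P \<Longrightarrow> \<not> elliptic (\<gamma> \<sigma>)"
    and "\<And>C. C \<in> edge_classes P \<gamma> \<Longrightarrow> (\<Sum>e\<in>C. dihedral_angle P e) = 2 * pi"
  shows "real (card (edge_classes P \<gamma>)) =
    (real (card {e. e edge_of P}) - real (card (vertices P))) / 2"
proof -
  interpret ideal_polyhedron P
    by unfold_locales (rule assms(2))
  have "2 * pi * real (card (edge_classes P \<gamma>)) =
      (\<Sum>C\<in>edge_classes P \<gamma>. \<Sum>e\<in>C. dihedral_angle P e)"
    by (simp add: assms(5))
  also have "\<dots> = (\<Sum>e | e edge_of P. dihedral_angle P e)"
    by (rule sum_over_edge_classes[OF finite_edges])
  also have "\<dots> = pi * (real (card {e. e edge_of P}) - real (card (vertices P)))"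
    by (rule sum_dihedral_angles)
  finally show ?thesis by simp
qed

end
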